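(* Let $k\ge 1$ be an integer, let $E\subset\mathbb{R}^k$ be measurable and let $f:E\to\ell^\infty$ be a Lipschitz mapping. Then $\mathcal{H}^k(f(E))=0$ if and only if $\operatorname{rank}(\operatorname{ap}Df(x))<k$ for $\mathcal{H}^k$-a.e. $x\in E$.
   Context: $\ell^\infty$ is the Banach space of bounded real sequences with the supremum norm; $\mathcal{H}^k$ is the $k$-dimensional Hausdorff measure (Lebesgue measure on $\mathbb{R}^k$; on $\ell^\infty$ taken with respect to the norm metric). A measurable function $h:E\to\mathbb{R}$ on a measurable set $E\subset\mathbb{R}^k$ is approximately differentiable at $x\in E$ if there are a measurable set $E_x\subset E$ and a linear function $L:\mathbb{R}^k\to\mathbb{R}$ such that $x$ is a density point of $E_x$ and $\lim_{E_x\ni y\to x}\frac{h(y)-h(x)-L(y-x)}{|y-x|}=0$. The map $L$ is unique if it exists and is denoted $\operatorname{ap}Dh(x)$ (identified with a vector in $\mathbb{R}^k$). Lipschitz functions $E\to\mathbb{R}$ are approximately differentiable a.e. in $E$. For a Lipschitz $f=(f_1,f_2,\dots):E\to\ell^\infty$, every component $f_i$ is Lipschitz, so at a.e. $x\in E$ all $f_i$ are approximately differentiable, and one defines $\operatorname{ap}Df(x)=(\operatorname{ap}Df_1(x),\operatorname{ap}Df_2(x),\dots)$. Its rank, $\operatorname{rank}(\operatorname{ap}Df(x))$, is the dimension of the linear subspace of $\mathbb{R}^k$ spanned by the vectors $\operatorname{ap}Df_i(x)$, $i\in\mathbb{N}$. *)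

theory Defs
  imports "HOL-Analysis.Analysis"
begin

text \<open>\<open>nat\<close> carries the discrete topology, so the bounded continuous functions on it are exactly
  the bounded real sequences, with the supremum norm.\<close>

type_synonym linf = "nat \<Rightarrow>\<^sub>C real"

text \<open>
  The factor \<open>unit_ball_vol k / 2 ^ k\<close> makes the \<open>k\<close>-dimensional Hausdorff measure on
  \<open>\<real>\<^sup>k\<close> coincide with Lebesgue measure.  The case distinction only matters for \<open>k = 0\<close>
  (where \<open>0 ^ 0 = 1\<close>): empty covering sets never contribute.  The sets \<open>C i\<close> are required to be
  bounded because \<^const>\<open>diameter\<close> is meaningless on unbounded sets.  If there is no admissible
  countable cover, the infimum is \<open>\<infinity>\<close>.
\<close>

definition hausdorff_pre :: "nat \<Rightarrow> real \<Rightarrow> 'a::metric_space set \<Rightarrow> ennreal" where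
  "hausdorff_pre k \<delta> A =
     (INF C \<in> {C :: nat \<Rightarrow> 'a set. A \<subseteq> (\<Union>i. C i) \<and> (\<forall>i. bounded (C i) \<and> diameter (C i) \<le> \<delta>)}.
        (\<Sum>i. if C i = {} then 0
              else ennreal (unit_ball_vol (real k) / 2 ^ k * diameter (C i) ^ k)))"

text \<open>An outer measure, defined on all subsets; the supremum is the limit as \<open>\<delta>\<close> tends to \<open>0\<close>.\<close>

definition hausdorff_measure :: "nat \<Rightarrow> 'a::metric_space set \<Rightarrow> ennreal" where
  "hausdorff_measure k A = (SUP \<delta> \<in> {0<..}. hausdorff_pre k \<delta> A)"

definition density_point :: "'a::euclidean_space set \<Rightarrow> 'a \<Rightarrow> bool" where
  "density_point S x \<longleftrightarrow>
     ((\<lambda>r. measure lebesgue (S \<inter> ball x r) / measure lebesgue (ball x r)) \<longlongrightarrow> 1) (at_right 0)"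

text \<open>\<open>L\<close> is an approximate differential at \<open>x\<close> of \<open>h\<close>, regarded as a function on \<open>E\<close>.\<close>

definition has_ap_derivative ::
    "('a::euclidean_space \<Rightarrow> real) \<Rightarrow> ('a \<Rightarrow> real) \<Rightarrow> 'a set \<Rightarrow> 'a \<Rightarrow> bool" where
  "has_ap_derivative h L E x \<longleftrightarrow>
     x \<in> E \<and> linear L \<and>
     (\<exists>Ex. Ex \<in> sets lebesgue \<and> Ex \<subseteq> E \<and> density_point Ex x \<and>
        ((\<lambda>y. (h y - h x - L (y - x)) / norm (y - x)) \<longlongrightarrow> 0) (at x within Ex))"

text \<open>
  The approximate differential as a vector.  It is unique when it exists; at points where
  \<open>h\<close> is not approximately differentiable the value is unspecified.  For Lipschitz \<open>h\<close> these
  points form a null subset of \<open>E\<close>.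
\<close>

definition apD :: "('a::euclidean_space \<Rightarrow> real) \<Rightarrow> 'a set \<Rightarrow> 'a \<Rightarrow> 'a" where
  "apD h E x = (THE v. has_ap_derivative h (\<lambda>w. v \<bullet> w) E x)"

definition apD_linf :: "('a::euclidean_space \<Rightarrow> linf) \<Rightarrow> 'a set \<Rightarrow> 'a \<Rightarrow> nat \<Rightarrow> 'a" where
  "apD_linf f E x = (\<lambda>i. apD (\<lambda>y. apply_bcontfun (f y) i) E x)"

definition rank_seq :: "(nat \<Rightarrow> 'a::euclidean_space) \<Rightarrow> nat" where
  "rank_seq v = dim (span (range v))"

end

(*
  Hausdorff measure zero is the same as Hausdorff content zero, and the content behaves well under Lipschitz
  maps and Vitali coverings; Lebesgue's density theorem is one such covering argument.

  For a C-Lipschitz g on R^k, the map adding (g x + C x_j) e_j to x is bi-Lipschitz, so the volume of its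
  images has a Radon-Nikodym density, which serves as 1 + C + the j-th partial derivative of g.  If this
  density is close to a constant on a set having x as a density point, comparing the volumes of thin boxes
  with those of their images controls the increments of g in direction e_j from all points near x.  This
  yields Rademacher's theorem, and, since only the density at x of one set enters, estimates that are
  uniform over infinitely many functions g.

  If the derivative has rank k at x, then |f y - f x| >= c |y - x| near x, by compactness of the sphere.
  The set of such x is a countable union of pieces on which f has a Lipschitz inverse, so it is null
  when f(E) is.

  If all components have zero derivative in a common direction u at x, the uniform estimate shows that f
  maps each tube of width r/n in direction u inside the ball of radius r around x to a set of diameter
  O(r/n).  About n^(k-1) tubes fill the ball, so the image has content O(r^k/n); a Vitali covering concludes.
*)

theory Submission
  imports Defs
begin

text \<open>A Lipschitz map into \<open>linf\<close> may be nowhere differentiable in norm although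
  all its components are smooth: take \<open>(sin x, sin (2 x) / 2, sin (3 x) / 3, ...)\<close>. The
  remainders of the components are not small at a common scale, so derivatives of the components
  alone do not bound the diameter of an image. This matters at rank-deficient points, where all
  components must be bounded above at once; the lower bound at full rank treats each component
  separately. Hence slopes are read off from densities: conditions on countably many densities cut
  out one measurable set, and its density at \<open>x\<close> supplies one scale for all components.
  A second obstacle is that the degenerate direction depends on \<open>x\<close>, whereas
  exceptional null sets can be discarded only for countably many directions. So directions run
  through a countable dense subset of the sphere, and slopes are asked to be small instead of zero.
  Each component is extended separately to the whole space; at density points of \<open>E\<close>
  its approximate differential is a classical derivative of the extension.\<close>

section \<open>Hausdorff content\<close>

text \<open>Unlike the Hausdorff measure, the content imposes no bound on the diameters of the covering sets.\<close>
definition hausdorff_content :: "nat \<Rightarrow> 'a::metric_space set \<Rightarrow> ennreal" where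
  "hausdorff_content k A =
     (INF C \<in> {C :: nat \<Rightarrow> 'a set. A \<subseteq> (\<Union>i. C i) \<and> (\<forall>i. bounded (C i))}.
        (\<Sum>i. ennreal (diameter (C i) ^ k)))"

lemma hausdorff_content_le:
  assumes "A \<subseteq> (\<Union>i. C i)" "\<And>i. bounded (C i)"
  shows "hausdorff_content k A \<le> (\<Sum>i. ennreal (diameter (C i) ^ k))"
  unfolding hausdorff_content_def by (rule INF_lower) (use assms in auto)

lemma hausdorff_content_mono: "A \<subseteq> B \<Longrightarrow> hausdorff_content k A \<le> hausdorff_content k B"
  unfolding hausdorff_content_def by (rule INF_superset_mono) auto

lemma hausdorff_content_less:
  assumes "hausdorff_content k A < e"
  obtains C where "A \<subseteq> (\<Union>i. C i)" "\<And>i. bounded (C i)" "(\<Sum>i. ennreal (diameter (C i) ^ k)) < e"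
  using assms unfolding hausdorff_content_def INF_less_iff by auto

lemma hausdorff_content_countable_subadditive:
  fixes A :: "nat \<Rightarrow> 'a::metric_space set"
  shows "hausdorff_content k (\<Union>i. A i) \<le> (\<Sum>i. hausdorff_content k (A i))"
proof (rule ennreal_le_epsilon)
  fix e :: real assume fin: "(\<Sum>i. hausdorff_content k (A i)) < top" and e: "0 < e"
  have finite_i: "hausdorff_content k (A i) < top" for i
    using ennreal_suminf_lessD[OF fin] .
  have "\<exists>C. A i \<subseteq> (\<Union>n. C n) \<and> (\<forall>n. bounded (C n)) \<and>
      (\<Sum>n. ennreal (diameter (C n) ^ k)) \<le> hausdorff_content k (A i) + ennreal (e * (1/2)^Suc i)" for i
  proof -
    have "hausdorff_content k (A i) < hausdorff_content k (A i) + ennreal (e * (1/2)^Suc i)"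
      using finite_i[of i] e by (simp add: ennreal_add_left_cancel_less)
    from hausdorff_content_less[OF this] show ?thesis by (metis less_imp_le)
  qed
  then obtain C where C: "\<And>i. A i \<subseteq> (\<Union>n. C i n)" "\<And>i n. bounded (C i n)"
      "\<And>i. (\<Sum>n. ennreal (diameter (C i n) ^ k)) \<le> hausdorff_content k (A i) + ennreal (e * (1/2)^Suc i)"
    by metis
  define D where "D m = (case prod_decode m of (i, n) \<Rightarrow> C i n)" for m
  have cover: "(\<Union>i. A i) \<subseteq> (\<Union>m. D m)"
  proof
    fix x assume "x \<in> (\<Union>i. A i)"
    then obtain i n where "x \<in> C i n" using C(1) by blast
    then have "x \<in> D (prod_encode (i, n))" by (simp add: D_def)
    then show "x \<in> (\<Union>m. D m)" by blast
  qed
  have "hausdorff_content k (\<Union>i. A i) \<le> (\<Sum>m. ennreal (diameter (D m) ^ k))"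
    by (rule hausdorff_content_le[OF cover]) (auto simp: D_def C(2) split: prod.split)
  also have "\<dots> = (\<Sum>i. \<Sum>n. ennreal (diameter (C i n) ^ k))"
    using suminf_ennreal_2dimen[of "\<lambda>i. \<Sum>n. ennreal (diameter (C i n) ^ k)" "\<lambda>(i,n). ennreal (diameter (C i n) ^ k)"]
    by (simp add: D_def split_beta)
  also have "\<dots> \<le> (\<Sum>i. hausdorff_content k (A i) + ennreal (e * (1/2)^Suc i))"
    by (intro suminf_le C(3)) auto
  also have "\<dots> = (\<Sum>i. hausdorff_content k (A i)) + (\<Sum>i. ennreal (e * (1/2)^Suc i))"
    by (rule suminf_add[symmetric]) auto
  also have "(\<Sum>i. ennreal (e * (1/2)^Suc i)) = ennreal e"
    using e by (intro suminf_ennreal_eq) (use sums_mult[OF power_half_series, of e] in auto)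
  finally show "hausdorff_content k (\<Union>i. A i) \<le> (\<Sum>i. hausdorff_content k (A i)) + ennreal e" .
qed

text \<open>Positivity of \<open>k\<close> matters: for \<open>k = 0\<close> every member of a
  cover, even an empty one, costs \<open>0 ^ 0 = 1\<close>, and all contents are infinite.\<close>

lemma hausdorff_content_empty: "0 < k \<Longrightarrow> hausdorff_content k ({} :: 'a::metric_space set) = 0"
proof -
  assume k: "0 < k"
  have "hausdorff_content k ({} :: 'a set) \<le> (\<Sum>i::nat. ennreal (diameter ({} :: 'a set) ^ k))"
    by (rule hausdorff_content_le[where C="\<lambda>_. {}"]) simp_all
  also have "\<dots> = 0" using k by (simp add: zero_power)
  finally show "hausdorff_content k ({} :: 'a set) = 0" by simp
qed

lemma hausdorff_content_UN_countable_null: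
  assumes "countable I" "\<And>i. i \<in> I \<Longrightarrow> hausdorff_content k (A i) = 0" "0 < k"
  shows "hausdorff_content k (\<Union>i\<in>I. A i) = 0"
proof (cases "I = {}")
  case True
  then show ?thesis using assms(3) by (simp add: hausdorff_content_empty)
next
  case False
  have "(\<Union>i\<in>I. A i) = (\<Union>n. A (from_nat_into I n))"
    using range_from_nat_into[OF False assms(1)] by (metis image_image)
  also have "hausdorff_content k \<dots> \<le> (\<Sum>n. hausdorff_content k (A (from_nat_into I n)))"
    by (rule hausdorff_content_countable_subadditive)
  also have "\<dots> = 0" using assms(2) from_nat_into[OF False] by simp
  finally show ?thesis by simp
qed

lemma hausdorff_content_finite_cover:
  assumes "finite M" "A \<subseteq> (\<Union>m\<in>M. P m)" "0 < k"
    "\<And>m. m \<in> M \<Longrightarrow> bounded (P m)" "\<And>m. m \<in> M \<Longrightarrow> diameter (P m) \<le> d"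
  shows "hausdorff_content k A \<le> ennreal (real (card M) * d ^ k)"
proof -
  obtain h where h: "bij_betw h {..<card M} M"
    using ex_bij_betw_nat_finite[OF assms(1)] by (auto simp: atLeast0LessThan)
  \<comment> \<open>Padding with empty sets is free, because \<open>0 ^ k = 0\<close> for positive
    \<open>k\<close>.\<close>
  define C where "C i = (if i < card M then P (h i) else {})" for i
  have hM: "i < card M \<Longrightarrow> h i \<in> M" for i using h by (auto simp: bij_betw_def)
  have "A \<subseteq> (\<Union>i. C i)"
  proof
    fix x assume "x \<in> A"
    then obtain m where m: "m \<in> M" "x \<in> P m" using assms(2) by auto
    then obtain i where "i < card M" "h i = m" using h by (metis bij_betw_iff_bijections lessThan_iff)
    then have "x \<in> C i" using m by (simp add: C_def)
    then show "x \<in> (\<Union>i. C i)" by blast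
  qed
  then have "hausdorff_content k A \<le> (\<Sum>i. ennreal (diameter (C i) ^ k))"
    by (rule hausdorff_content_le) (auto simp: C_def hM assms(4))
  also have "\<dots> = (\<Sum>i<card M. ennreal (diameter (C i) ^ k))"
    by (rule suminf_finite) (use assms(3) in \<open>auto simp: C_def\<close>)
  also have "\<dots> \<le> (\<Sum>i<card M. ennreal (d ^ k))"
    by (intro sum_mono ennreal_leI power_mono)
       (auto simp: C_def hM assms(4,5) intro!: diameter_ge_0)
  also have "\<dots> = ennreal (real (card M) * d ^ k)"
    by (cases "card M = 0") (auto simp: ennreal_mult'' ennreal_of_nat_eq_real_of_nat[symmetric] ennreal_mult')
  finally show ?thesis .
qed

lemma hausdorff_content_le_diameter:
  assumes "bounded A" "0 < k"
  shows "hausdorff_content k A \<le> ennreal (diameter A ^ k)"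
  using hausdorff_content_finite_cover[of "{()}" A "\<lambda>_. A" k "diameter A"] assms by simp

lemma diameter_lipschitz_image:
  assumes L: "L-lipschitz_on S f" and S: "bounded S"
  shows "bounded (f ` S)" "diameter (f ` S) \<le> L * diameter S"
proof -
  have L0: "0 \<le> L" using L by (rule lipschitz_on_nonneg)
  have d: "dist (f x) (f y) \<le> L * diameter S" if "x \<in> S" "y \<in> S" for x y
    using lipschitz_onD[OF L that] mult_left_mono[OF diameter_bounded_bound[OF S that] L0] by linarith
  show "bounded (f ` S)"
    unfolding bounded_two_points using d by blast
  show "diameter (f ` S) \<le> L * diameter S"
    using d L0 diameter_ge_0[OF S] by (auto simp: diameter_def[of "f ` S"] intro!: cSUP_least)
qed

lemma hausdorff_content_lipschitz_image:
  assumes L: "L-lipschitz_on A f" "0 < L" and k: "0 < k"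
  shows "hausdorff_content k (f ` A) \<le> ennreal (L ^ k) * hausdorff_content k A"
proof -
  \<comment> \<open>Multiplying by the reciprocal \<open>b\<close> turns the claim into a lower
    bound for the infimum defining \<open>hausdorff_content k A\<close>, which can be checked cover
    by cover. Covering sets are cut down to \<open>A\<close>, since \<open>f\<close> is Lipschitz
    only there.\<close>
  define a b where "a = ennreal (L ^ k)" and "b = ennreal ((1 / L) ^ k)"
  have ab: "a * b = 1"
    using L(2) by (simp add: a_def b_def ennreal_mult'[symmetric] power_mult_distrib[symmetric])
  have "b * hausdorff_content k (f ` A) \<le> (\<Sum>i. ennreal (diameter (C i) ^ k))"
    if C: "A \<subseteq> (\<Union>i. C i)" "\<And>i. bounded (C i)" for C :: "nat \<Rightarrow> 'a set"
  proof -
    have bd: "bounded (f ` (A \<inter> C i))" "diameter (f ` (A \<inter> C i)) \<le> L * diameter (C i)" for i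
    proof -
      have Li: "L-lipschitz_on (A \<inter> C i) f" using L(1) by (rule lipschitz_on_subset) auto
      have Ai: "bounded (A \<inter> C i)" using C(2) by (meson bounded_Int)
      show "bounded (f ` (A \<inter> C i))" by (rule diameter_lipschitz_image[OF Li Ai])
      have "diameter (A \<inter> C i) \<le> diameter (C i)" by (rule diameter_subset) (use C in auto)
      then show "diameter (f ` (A \<inter> C i)) \<le> L * diameter (C i)"
        using diameter_lipschitz_image(2)[OF Li Ai] L(2) by (meson mult_left_mono less_imp_le order_trans)
    qed
    have "hausdorff_content k (f ` A) \<le> (\<Sum>i. ennreal (diameter (f ` (A \<inter> C i)) ^ k))"
      proof (rule hausdorff_content_le)
      show "f ` A \<subseteq> (\<Union>i. f ` (A \<inter> C i))" unfolding image_UN[symmetric] Int_UN_distrib[symmetric] using C(1) by blast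
    qed (rule bd)
    also have "\<dots> \<le> (\<Sum>i. a * ennreal (diameter (C i) ^ k))"
      using bd L(2) by (intro suminf_le)
        (auto simp: ennreal_mult'[symmetric] power_mult_distrib[symmetric] a_def
              intro!: ennreal_leI power_mono diameter_ge_0)
    finally have "b * hausdorff_content k (f ` A) \<le> b * (a * (\<Sum>i. ennreal (diameter (C i) ^ k)))"
      by (intro mult_left_mono) auto
    then show ?thesis using ab by (simp add: mult.assoc[symmetric] mult.commute[of b])
  qed
  then have "b * hausdorff_content k (f ` A) \<le> hausdorff_content k A"
    unfolding hausdorff_content_def[of k A] by (intro INF_greatest) auto
  then have "a * (b * hausdorff_content k (f ` A)) \<le> a * hausdorff_content k A"
    by (intro mult_left_mono) auto
  then show ?thesis using ab by (simp add: mult.assoc[symmetric] a_def)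
qed

text \<open>For null sets the bound on diameters in \<open>hausdorff_pre\<close> is automatic: if
  all the \<open>diameter (C i) ^ k\<close> sum to less than \<open>\<delta> ^ k\<close>, then each
  diameter is at most \<open>\<delta>\<close>. The normalizing factor merely rescales the
  sums.\<close>

lemma hausdorff_measure_eq_0_iff:
  fixes A :: "'a::metric_space set"
  assumes k: "0 < k"
  shows "hausdorff_measure k A = 0 \<longleftrightarrow> hausdorff_content k A = 0"
proof
  define c where "c = unit_ball_vol (real k) / 2 ^ k"
  have c: "0 < c" by (simp add: c_def)
  have term_eq: "(if S = {} then 0 else ennreal (c * diameter S ^ k)) = ennreal c * ennreal (diameter S ^ k)"
    for S :: "'a set" using k c by (simp add: ennreal_mult')
  have pre: "hausdorff_pre k \<delta> A =
      (INF C \<in> {C :: nat \<Rightarrow> 'a set. A \<subseteq> (\<Union>i. C i) \<and> (\<forall>i. bounded (C i) \<and> diameter (C i) \<le> \<delta>)}.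
        ennreal c * (\<Sum>i. ennreal (diameter (C i) ^ k)))" for \<delta>
    unfolding hausdorff_pre_def c_def[symmetric] term_eq by simp
  {
    assume "hausdorff_measure k A = 0"
    then have "hausdorff_pre k 1 A = 0"
      unfolding hausdorff_measure_def by (auto simp: SUP_eq_iff bot_ennreal[symmetric])
    have "hausdorff_content k A < e" if "0 < e" "e < top" for e
    proof -
      have "hausdorff_pre k 1 A < ennreal c * e"
        using \<open>hausdorff_pre k 1 A = 0\<close> that c by (simp add: ennreal_zero_less_mult_iff)
      then obtain C where C: "A \<subseteq> (\<Union>i. C i)" "\<And>i. bounded (C i)"
          "ennreal c * (\<Sum>i. ennreal (diameter (C i) ^ k)) < ennreal c * e"
        unfolding pre INF_less_iff by auto
      have "(\<Sum>i. ennreal (diameter (C i) ^ k)) < e"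
        using C(3) by (meson mult_left_mono not_le zero_le)
      then show ?thesis using hausdorff_content_le[OF C(1,2), of k] by simp
    qed
    then show "hausdorff_content k A = 0"
      by (metis ennreal_one_less_top gr_zeroI less_irrefl less_top not_less_iff_gr_or_eq zero_less_one order.strict_trans)
  }
  assume 0: "hausdorff_content k A = 0"
  have "hausdorff_pre k \<delta> A \<le> 0" if \<delta>: "0 < \<delta>" for \<delta>
  proof (rule ennreal_le_epsilon)
    fix e :: real assume e: "0 < e"
    \<comment> \<open>The first bound absorbs the factor \<open>c\<close>, the second forces all
      diameters below \<open>\<delta>\<close>.\<close>
    define e' where "e' = min (e / c) (\<delta> ^ k)"
    have e': "0 < e'" "c * e' \<le> e" "e' \<le> \<delta> ^ k"
      using e c \<delta> by (auto simp: e'_def min_def field_simps not_le)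
    have "hausdorff_content k A < ennreal e'" using 0 e' by simp
    then obtain C where C: "A \<subseteq> (\<Union>i. C i)" "\<And>i. bounded (C i)"
        "(\<Sum>i. ennreal (diameter (C i) ^ k)) < ennreal e'"
      by (rule hausdorff_content_less) blast
    have "diameter (C i) \<le> \<delta>" for i
    proof -
      have "ennreal (diameter (C i) ^ k) \<le> (\<Sum>i. ennreal (diameter (C i) ^ k))"
        using sum_le_suminf[of "\<lambda>i. ennreal (diameter (C i) ^ k)" "{i}"] by simp
      also have "\<dots> \<le> ennreal (\<delta> ^ k)" using C(3) e'(3) by (meson ennreal_leI less_imp_le order_trans)
      finally have "diameter (C i) ^ k \<le> \<delta> ^ k" using \<delta> by (simp add: ennreal_le_iff)
      then show ?thesis using \<delta> k by (simp add: power_mono_iff diameter_ge_0 C(2))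
    qed
    then have "hausdorff_pre k \<delta> A \<le> ennreal c * (\<Sum>i. ennreal (diameter (C i) ^ k))"
      unfolding pre by (intro INF_lower) (use C in auto)
    also have "\<dots> \<le> ennreal c * ennreal e'" using C(3) by (intro mult_left_mono) auto
    also have "\<dots> \<le> ennreal e" using e'(1,2) c by (simp add: ennreal_mult'[symmetric] ennreal_leI)
    finally show "hausdorff_pre k \<delta> A \<le> 0 + ennreal e" by simp
  qed
  then show "hausdorff_measure k A = 0"
    unfolding hausdorff_measure_def by (auto simp: SUP_eq_iff bot_ennreal)
qed

section \<open>Vitali coverings and Lebesgue density\<close>

text \<open>The selected balls are disjoint while their fivefold enlargements still cover \<open>A\<close>.\<close>
lemma hausdorff_content_image_le_Vitali:
  fixes f :: "'a::euclidean_space \<Rightarrow> 'm::metric_space" and N :: "'a measure"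
  assumes m: "0 < m" and N: "sets borel \<subseteq> sets N" and U: "U \<in> sets N"
    and ball: "\<And>x. x \<in> A \<Longrightarrow> \<exists>r>0. r \<le> 1 \<and> cball x r \<subseteq> U \<and>
        hausdorff_content m (f ` (A \<inter> cball x (5 * r))) \<le> emeasure N (cball x r)"
  shows "hausdorff_content m (f ` A) \<le> emeasure N U"
proof -
  obtain r where r: "\<And>x. x \<in> A \<Longrightarrow> 0 < r x \<and> r x \<le> 1 \<and> cball x (r x) \<subseteq> U \<and>
        hausdorff_content m (f ` (A \<inter> cball x (5 * r x))) \<le> emeasure N (cball x (r x))"
    using ball by metis
  have "A \<subseteq> (\<Union>x\<in>A. cball x (r x))" using r by force
  then obtain C where C: "countable C" "C \<subseteq> A"
     "pairwise (\<lambda>i j. disjnt (cball i (r i)) (cball j (r j))) C"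
     "A \<subseteq> (\<Union>i\<in>C. cball i (5 * r i))"
    using Vitali_covering_lemma_cballs[where S=A and K=A and a="\<lambda>x. x" and r=r and B=1] r by blast
  define J where "J n = {i \<in> C. to_nat_on C i = n}" for n
  have J1: "J n = {} \<or> (\<exists>i\<in>C. J n = {i})" for n
    using inj_on_to_nat_on[OF C(1)] unfolding J_def inj_on_def by blast
  have JC: "(\<Union>n. J n) = C" by (auto simp: J_def)
  define B where "B n = (\<Union>i\<in>J n. cball i (r i))" for n
  define P where "P n = (\<Union>i\<in>J n. f ` (A \<inter> cball i (5 * r i)))" for n
  have "f ` A \<subseteq> (\<Union>n. P n)"
  proof
    fix y assume "y \<in> f ` A"
    then obtain x i where "x \<in> A" "y = f x" "i \<in> C" "x \<in> cball i (5 * r i)" using C(4) by blast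
    then have "y \<in> P (to_nat_on C i)" by (auto simp: P_def J_def)
    then show "y \<in> (\<Union>n. P n)" by blast
  qed
  then have "hausdorff_content m (f ` A) \<le> hausdorff_content m (\<Union>n. P n)"
    by (rule hausdorff_content_mono)
  also have "\<dots> \<le> (\<Sum>n. hausdorff_content m (P n))"
    by (rule hausdorff_content_countable_subadditive)
  also have "\<dots> \<le> (\<Sum>n. emeasure N (B n))"
  proof (rule suminf_le)
    fix n show "hausdorff_content m (P n) \<le> emeasure N (B n)"
      using J1[of n] r C(2) by (auto simp: P_def B_def hausdorff_content_empty m)
  qed auto
  also have "\<dots> = emeasure N (\<Union>n. B n)"
  proof (rule suminf_emeasure)
    show "range B \<subseteq> sets N"
    proof safe
      fix n
      have "B n \<in> sets borel" using J1[of n] by (auto simp: B_def)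
      then show "B n \<in> sets N" using N by blast
    qed
    show "disjoint_family B"
    proof (unfold disjoint_family_on_def, intro ballI impI)
      fix n p :: nat assume "n \<noteq> p"
      have "cball i (r i) \<inter> cball j (r j) = {}" if "i \<in> J n" "j \<in> J p" for i j
      proof -
        have "i \<in> C" "j \<in> C" "i \<noteq> j" using that \<open>n \<noteq> p\<close> by (auto simp: J_def)
        then show ?thesis using C(3) by (simp add: pairwise_def disjnt_def)
      qed
      then show "B n \<inter> B p = {}" by (auto simp: B_def)
    qed
  qed
  also have "\<dots> \<le> emeasure N U"
    by (rule emeasure_mono) (use r C(2) U in \<open>auto simp: B_def J_def subset_iff\<close>)
  finally show ?thesis .
qed

text \<open>The Vitali argument for the identity map: an enlarged ball of radius
  \<open>5 * r\<close> has diameter \<open>10 * r\<close>, and \<open>(10 * r) ^ k\<close> is the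
  stated multiple of the volume of \<open>cball x r\<close>.\<close>

lemma hausdorff_content_le_open:
  fixes U :: "'a::euclidean_space set"
  assumes U: "open U"
  shows "hausdorff_content DIM('a) U \<le> ennreal (10 ^ DIM('a) / unit_ball_vol DIM('a)) * emeasure lborel U"
proof -
  let ?k = "DIM('a)"
  let ?c = "ennreal (10 ^ ?k / unit_ball_vol ?k)"
  let ?N = "scale_measure ?c lborel :: 'a measure"
  have v: "unit_ball_vol ?k \<noteq> 0" using unit_ball_vol_pos[of ?k] by linarith
  have "hausdorff_content ?k ((\<lambda>x. x) ` U) \<le> emeasure ?N U"
  proof (rule hausdorff_content_image_le_Vitali)
    fix x assume "x \<in> U"
    then obtain e where e: "0 < e" "cball x e \<subseteq> U" using U open_contains_cball by blast
    define r where "r = min e 1"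
    have r: "0 < r" "r \<le> 1" "cball x r \<subseteq> U" using e by (auto simp: r_def subset_iff)
    have "hausdorff_content ?k ((\<lambda>x. x) ` (U \<inter> cball x (5*r))) \<le> hausdorff_content ?k (cball x (5*r))"
      by (rule hausdorff_content_mono) auto
    also have "\<dots> \<le> ennreal (diameter (cball x (5*r)) ^ ?k)"
      by (rule hausdorff_content_le_diameter) auto
    also have "diameter (cball x (5*r)) ^ ?k = 10 ^ ?k / unit_ball_vol ?k * (unit_ball_vol ?k * r ^ ?k)"
      using r v by (simp add: power_mult_distrib)
    also have "\<dots> = emeasure ?N (cball x r)"
      unfolding emeasure_scale_measure using r emeasure_cball[of r x]
      by (subst ennreal_mult'') auto
    finally show "\<exists>r>0. r \<le> 1 \<and> cball x r \<subseteq> U \<and>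
        hausdorff_content ?k ((\<lambda>x. x) ` (U \<inter> cball x (5 * r))) \<le> emeasure ?N (cball x r)"
      using r by blast
  qed (use U in auto)
  then show ?thesis by simp
qed

lemma hausdorff_content_le_lebesgue:
  fixes S :: "'a::euclidean_space set"
  assumes S: "S \<in> sets lebesgue"
  shows "hausdorff_content DIM('a) S \<le> ennreal (10 ^ DIM('a) / unit_ball_vol DIM('a)) * emeasure lebesgue S"
proof (rule ennreal_le_epsilon)
  let ?c = "10 ^ DIM('a) / unit_ball_vol DIM('a)"
  have v: "0 < unit_ball_vol DIM('a)" by simp
  then have c: "0 < ?c" by simp
  fix e :: real assume e: "0 < e"
  obtain T where T: "open T" "S \<subseteq> T" "T - S \<in> lmeasurable" "emeasure lebesgue (T - S) < ennreal (e / ?c)"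
    using sets_lebesgue_outer_open[OF S, of "e / ?c"] e c by auto
  have "hausdorff_content DIM('a) S \<le> hausdorff_content DIM('a) T"
    by (rule hausdorff_content_mono) fact
  also have "\<dots> \<le> ennreal ?c * emeasure lborel T" by (rule hausdorff_content_le_open) fact
  also have "emeasure lborel T = emeasure lebesgue T" using T(1) by simp
  also have "emeasure lebesgue T = emeasure lebesgue S + emeasure lebesgue (T - S)"
    using plus_emeasure[of S lebesgue "T - S"] S T by (simp add: Un_absorb1 fmeasurableD)
  also have "ennreal ?c * \<dots> \<le> ennreal ?c * (emeasure lebesgue S + ennreal (e / ?c))"
    using T(4) by (intro mult_left_mono add_left_mono) auto
  also have "\<dots> = ennreal ?c * emeasure lebesgue S + ennreal e"
    using c e v by (simp add: distrib_left ennreal_mult'[symmetric] order_less_imp_not_eq2)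
  finally show "hausdorff_content DIM('a) S \<le> ennreal ?c * emeasure lebesgue S + ennreal e" .
qed

text \<open>A bounded set lies in the ball around any of its points whose radius is the diameter of
  the set. Compared with the optimal constant this loses a factor \<open>2 ^ k\<close>, which is
  harmless where only comparability counts.\<close>

lemma hausdorff_content_borel_cover:
  fixes A :: "'a::euclidean_space set"
  assumes "hausdorff_content DIM('a) A < e"
  obtains T where "T \<in> sets borel" "A \<subseteq> T" "emeasure lborel T \<le> ennreal (unit_ball_vol DIM('a)) * e"
proof -
  obtain C where C: "A \<subseteq> (\<Union>i. C i)" "\<And>i. bounded (C i)" "(\<Sum>i. ennreal (diameter (C i) ^ DIM('a))) < e"
    by (rule hausdorff_content_less[OF assms]) blast
  define T where "T i = (if C i = {} then {} else cball (SOME x. x \<in> C i) (diameter (C i)))" for i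
  have sub: "C i \<subseteq> T i" for i
  proof
    fix y assume y: "y \<in> C i"
    then have "(SOME x. x \<in> C i) \<in> C i" by (rule someI)
    from diameter_bounded_bound[OF C(2) this y] y show "y \<in> T i" by (auto simp: T_def)
  qed
  have "emeasure lborel (\<Union>i. T i) \<le> (\<Sum>i. emeasure lborel (T i))"
    by (rule emeasure_subadditive_countably) (auto simp: T_def)
  also have "\<dots> \<le> (\<Sum>i. ennreal (unit_ball_vol DIM('a)) * ennreal (diameter (C i) ^ DIM('a)))"
    by (intro suminf_le) (auto simp: T_def emeasure_cball diameter_ge_0 C(2) ennreal_mult')
  also have "\<dots> \<le> ennreal (unit_ball_vol DIM('a)) * e"
    using C(3) by (simp add: mult_left_mono)
  finally have "emeasure lborel (\<Union>i. T i) \<le> ennreal (unit_ball_vol DIM('a)) * e" .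
  moreover have "(\<Union>i. T i) \<in> sets borel" by (auto simp: T_def)
  moreover have "A \<subseteq> (\<Union>i. T i)" using C(1) sub by blast
  ultimately show thesis using that by blast
qed

lemma emeasure_lebesgue_le_hausdorff_content:
  fixes S :: "'a::euclidean_space set"
  assumes S: "S \<in> sets lebesgue"
  shows "emeasure lebesgue S \<le> ennreal (unit_ball_vol DIM('a)) * hausdorff_content DIM('a) S"
proof (rule ennreal_le_epsilon)
  let ?v = "unit_ball_vol DIM('a)"
  have v: "0 < ?v" "?v \<noteq> 0" using unit_ball_vol_pos[of "DIM('a)"] by linarith+
  fix e :: real assume e: "0 < e" and fin: "ennreal ?v * hausdorff_content DIM('a) S < top"
  have "hausdorff_content DIM('a) S < top"
    using fin v by (auto simp: ennreal_mult_less_top)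
  then have "hausdorff_content DIM('a) S < hausdorff_content DIM('a) S + ennreal (e / ?v)"
    using e v by (simp add: ennreal_add_left_cancel_less)
  then obtain T where T: "T \<in> sets borel" "S \<subseteq> T"
      "emeasure lborel T \<le> ennreal ?v * (hausdorff_content DIM('a) S + ennreal (e / ?v))"
    by (rule hausdorff_content_borel_cover)
  have "emeasure lebesgue S \<le> emeasure lebesgue T"
    using T S by (intro emeasure_mono) auto
  also have "\<dots> \<le> ennreal ?v * (hausdorff_content DIM('a) S + ennreal (e / ?v))"
    using T by simp
  also have "\<dots> = ennreal ?v * hausdorff_content DIM('a) S + ennreal e"
    using v e by (simp add: distrib_left ennreal_mult'[symmetric])
  finally show "emeasure lebesgue S \<le> ennreal ?v * hausdorff_content DIM('a) S + ennreal e" .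
qed

lemma negligible_if_hausdorff_content_0:
  fixes A :: "'a::euclidean_space set"
  assumes "hausdorff_content DIM('a) A = 0"
  shows "negligible A"
proof (rule negligible_outer_le[THEN iffD2, rule_format])
  let ?v = "unit_ball_vol DIM('a)"
  have v: "?v \<noteq> 0" by (metis less_irrefl unit_ball_vol_pos of_nat_0_le_iff)
  fix e :: real assume e: "0 < e"
  then have "hausdorff_content DIM('a) A < ennreal (e / ?v)" using assms by simp
  then obtain T where T: "T \<in> sets borel" "A \<subseteq> T" "emeasure lborel T \<le> ennreal ?v * ennreal (e / ?v)"
    by (rule hausdorff_content_borel_cover)
  have "ennreal ?v * ennreal (e / ?v) = ennreal e" using e v by (simp add: ennreal_mult'[symmetric])
  then have Te: "emeasure lebesgue T \<le> ennreal e" using T by simp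
  then have "T \<in> lmeasurable" using T(1)
    by (intro fmeasurableI) (auto intro: le_less_trans)
  moreover have "measure lebesgue T \<le> e"
    using Te e by (simp add: measure_def enn2real_leI)
  ultimately show "\<exists>T. A \<subseteq> T \<and> T \<in> lmeasurable \<and> measure lebesgue T \<le> e"
    using T(2) by blast
qed

text \<open>Phrased through the volume of the missing part instead of a limit of ratios, so that it
  can be rescaled and inserted directly into volume estimates.\<close>

definition full_density :: "'a::euclidean_space set \<Rightarrow> 'a \<Rightarrow> bool" where
  "full_density A x \<longleftrightarrow>
     (\<forall>\<eta>>0. \<exists>\<delta>>0. \<forall>r. 0 < r \<and> r < \<delta> \<longrightarrow> emeasure lebesgue (cball x r - A) \<le> ennreal (\<eta> * r ^ DIM('a)))"

text \<open>A point of \<open>B \<eta>\<close> has arbitrarily small balls with more than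
  \<open>\<eta> * r ^ k\<close> of their volume outside \<open>A\<close>. The Vitali argument, with
  a multiple \<open>?N\<close> of the volume outside \<open>A\<close> and inside an open
  \<open>U\<close> containing \<open>A\<close>, bounds the content of \<open>B \<eta>\<close> by a
  multiple of the volume of \<open>U - A\<close>, which is as small as desired.\<close>

theorem Lebesgue_density:
  fixes A :: "'a::euclidean_space set"
  assumes A: "A \<in> sets lebesgue"
  shows "negligible {x \<in> A. \<not> full_density A x}"
proof -
  let ?k = "DIM('a)"
  define B where "B \<eta> = {x \<in> A. \<not> (\<exists>\<delta>>0. \<forall>r. 0 < r \<and> r < \<delta> \<longrightarrow>
      emeasure lebesgue (cball x r - A) \<le> ennreal (\<eta> * r ^ ?k))}" for \<eta>
  have "hausdorff_content ?k (B \<eta>) \<le> 0" if \<eta>: "0 < \<eta>" for \<eta>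
  proof (rule ennreal_le_epsilon)
    fix e :: real assume e: "0 < e"
    \<comment> \<open>Chosen so that \<open>(10 * r) ^ ?k = c * (\<eta> * r ^ ?k)\<close>, where
      \<open>10 * r\<close> is the diameter of the enlarged ball.\<close>
    define c where "c = 10 ^ ?k / \<eta>"
    have c: "0 < c" using \<eta> by (simp add: c_def)
    obtain U where U: "open U" "A \<subseteq> U" "U - A \<in> lmeasurable" "emeasure lebesgue (U - A) < ennreal (e / c)"
      using sets_lebesgue_outer_open[OF A, of "e / c"] e c by auto
    let ?N = "scale_measure (ennreal c) (density lebesgue (indicator (- A)))"
    have cA: "- A \<in> sets lebesgue" using sets.compl_sets[OF A] by (simp add: Compl_eq_Diff_UNIV)
    have N: "emeasure ?N X = ennreal c * emeasure lebesgue (X - A)" if "X \<in> sets lebesgue" for X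
      using emeasure_restricted[OF cA that] by (simp add: Diff_eq Int_commute del: emeasure_completion)
    have "hausdorff_content ?k ((\<lambda>x. x) ` B \<eta>) \<le> emeasure ?N U"
    proof (rule hausdorff_content_image_le_Vitali)
      fix x assume x: "x \<in> B \<eta>"
      then have "x \<in> U" using U(2) by (auto simp: B_def)
      then obtain d where d: "0 < d" "cball x d \<subseteq> U" using U(1) open_contains_cball by blast
      have "0 < min d 1" using d by simp
      then obtain r where r: "0 < r" "r < min d 1"
          "ennreal (\<eta> * r ^ ?k) < emeasure lebesgue (cball x r - A)"
        using x unfolding B_def mem_Collect_eq by (metis not_less)
      have "hausdorff_content ?k ((\<lambda>x. x) ` (B \<eta> \<inter> cball x (5*r))) \<le> hausdorff_content ?k (cball x (5*r))"
        by (rule hausdorff_content_mono) auto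
      also have "\<dots> \<le> ennreal (diameter (cball x (5*r)) ^ ?k)"
        by (rule hausdorff_content_le_diameter) auto
      also have "\<dots> = ennreal c * ennreal (\<eta> * r ^ ?k)"
      proof -
        have "diameter (cball x (5*r)) ^ ?k = c * (\<eta> * r ^ ?k)"
          using r \<eta> by (simp add: c_def power_mult_distrib)
        then show ?thesis using c r \<eta> by (simp add: ennreal_mult' mult.assoc)
      qed
      also have "\<dots> \<le> ennreal c * emeasure lebesgue (cball x r - A)"
        using r(3) by (intro mult_left_mono) auto
      also have "\<dots> = emeasure ?N (cball x r)" by (subst N) auto
      finally show "\<exists>r>0. r \<le> 1 \<and> cball x r \<subseteq> U \<and>
          hausdorff_content ?k ((\<lambda>x. x) ` (B \<eta> \<inter> cball x (5 * r))) \<le> emeasure ?N (cball x r)"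
        using r d by (intro exI[of _ r]) (auto simp: subset_iff)
    qed (use U in auto)
    also have "\<dots> = ennreal c * emeasure lebesgue (U - A)" using U(1) by (subst N) auto
    also have "\<dots> \<le> ennreal c * ennreal (e / c)" using U(4) by (intro mult_left_mono) auto
    also have "\<dots> = ennreal e" using c e by (simp add: ennreal_mult'[symmetric])
    finally show "hausdorff_content ?k (B \<eta>) \<le> 0 + ennreal e" by simp
  qed
  then have "negligible (\<Union>n. B (1 / Suc n))"
    by (intro negligible_countable_Union)
       (auto intro!: negligible_if_hausdorff_content_0 simp del: of_nat_Suc)
  moreover have "{x \<in> A. \<not> full_density A x} \<subseteq> (\<Union>n. B (1 / Suc n))"
  proof
    fix x assume "x \<in> {x \<in> A. \<not> full_density A x}"
    then obtain \<eta> where x: "x \<in> A" "0 < \<eta>" and n: "\<not> (\<exists>\<delta>>0. \<forall>r. 0 < r \<and> r < \<delta> \<longrightarrow>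
        emeasure lebesgue (cball x r - A) \<le> ennreal (\<eta> * r ^ ?k))"
      unfolding full_density_def by blast
    obtain n where "1 / Suc n < \<eta>" using nat_approx_posE[OF x(2)] by blast
    then have "ennreal (1 / Suc n * r ^ ?k) \<le> ennreal (\<eta> * r ^ ?k)" if "0 < r" for r
      using that by (intro ennreal_leI mult_right_mono) auto
    then have "x \<in> B (1 / Suc n)" using x(1) n unfolding B_def by (blast intro: order_trans)
    then show "x \<in> (\<Union>n. B (1 / Suc n))" by blast
  qed
  ultimately show ?thesis by (rule negligible_subset)
qed

section \<open>Increments of Lipschitz functions\<close>

lemma norm_le_DIM_mult:
  fixes x :: "'a::euclidean_space" and d :: real
  assumes "\<And>b. b \<in> Basis \<Longrightarrow> \<bar>x \<bullet> b\<bar> \<le> d"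
  shows "norm x \<le> DIM('a) * d"
  using norm_le_l1[of x] sum_bounded_above[of Basis "\<lambda>b. \<bar>x \<bullet> b\<bar>" d] assms by fastforce

locale lipschitz_stretch =
  fixes g :: "'a::euclidean_space \<Rightarrow> real" and C :: real and j :: 'a
  assumes g: "C-lipschitz_on UNIV g" and j: "j \<in> Basis"
begin

text \<open>Adding \<open>C (x \<bullet> j)\<close> makes the map increasing in direction \<open>j\<close>, hence bi-Lipschitz; the
  density of the pulled-back volume then plays the role of \<open>1 + C + \<partial>\<^sub>j g\<close>.\<close>
definition G :: "'a \<Rightarrow> 'a" where
  "G x = x + (g x + C * (x \<bullet> j)) *\<^sub>R j"

lemma C_nonneg: "0 \<le> C" using g by (rule lipschitz_on_nonneg)

lemma g_diff: "\<bar>g x - g y\<bar> \<le> C * norm (x - y)"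
  using lipschitz_onD[OF g, of x y] by (simp add: dist_norm)

lemma G_j: "G x \<bullet> j = (1 + C) * (x \<bullet> j) + g x"
  using j by (simp add: G_def inner_add_left algebra_simps)

lemma G_other: "b \<in> Basis \<Longrightarrow> b \<noteq> j \<Longrightarrow> G x \<bullet> b = x \<bullet> b"
  using j by (simp add: G_def inner_add_left inner_not_same_Basis)

lemma G_lipschitz: "(1 + 2 * C)-lipschitz_on S G"
proof (rule lipschitz_onI)
  fix x y
  have "G x - G y = (x - y) + ((g x - g y) + C * ((x - y) \<bullet> j)) *\<^sub>R j"
    by (simp add: G_def algebra_simps inner_diff_left)
  then have "norm (G x - G y) \<le> norm (x - y) + \<bar>(g x - g y) + C * ((x - y) \<bullet> j)\<bar>"
    using norm_triangle_ineq[of "x - y" "((g x - g y) + C * ((x - y) \<bullet> j)) *\<^sub>R j"] j by simp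
  also have "\<bar>(g x - g y) + C * ((x - y) \<bullet> j)\<bar> \<le> C * norm (x - y) + C * norm (x - y)"
    using g_diff[of x y] mult_left_mono[OF Basis_le_norm[OF j, of "x - y"] C_nonneg]
      C_nonneg by (auto simp: abs_mult intro!: order_trans[OF abs_triangle_ineq] add_mono)
  finally show "dist (G x) (G y) \<le> (1 + 2 * C) * dist x y"
    by (simp add: dist_norm algebra_simps)
qed (use C_nonneg in auto)

text \<open>Across \<open>j\<close> the displacement is visible in the coordinates that
  \<open>G\<close> preserves. Along \<open>j\<close> the term \<open>C * s\<close> absorbs the
  change of \<open>g\<close> caused by \<open>s\<close> itself, which leaves
  \<open>\<bar>s\<bar>\<close> at most \<open>norm D + C * norm d\<close>.\<close>

lemma norm_le_G: "norm (x - y) \<le> (3 + 2 * C) * norm (G x - G y)"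
proof -
  define s where "s = (x - y) \<bullet> j"
  define d where "d = x - y - s *\<^sub>R j"
  define D where "D = G x - G y"
  have Dj: "D \<bullet> j = s + C * s + (g x - g y)"
    by (simp add: D_def s_def inner_diff_left G_j algebra_simps)
  have "d = D - (D \<bullet> j) *\<^sub>R j"
    unfolding Dj by (simp add: d_def D_def G_def s_def algebra_simps inner_diff_left)
  then have d: "norm d \<le> 2 * norm D"
    using norm_triangle_ineq4[of D "(D \<bullet> j) *\<^sub>R j"] Basis_le_norm[OF j, of D] j by simp
  have xy: "norm (x - y) \<le> norm d + \<bar>s\<bar>"
    using norm_triangle_ineq[of d "s *\<^sub>R j"] j by (simp add: d_def)
  have "\<bar>g x - g y\<bar> \<le> C * norm d + C * \<bar>s\<bar>"
    using g_diff[of x y] mult_left_mono[OF xy C_nonneg] by (simp add: algebra_simps)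
  moreover have "\<bar>D \<bullet> j\<bar> \<le> norm D" using Basis_le_norm[OF j] .
  moreover have "\<bar>s + C * s\<bar> = \<bar>s\<bar> + C * \<bar>s\<bar>"
    using C_nonneg by (metis abs_mult abs_of_nonneg add_nonneg_nonneg distrib_right mult_1 zero_le_one)
  ultimately have "\<bar>s\<bar> \<le> norm D + C * norm d" using Dj by linarith
  also have "\<dots> \<le> norm D + C * (2 * norm D)" using d C_nonneg by (intro add_left_mono mult_left_mono)
  finally show ?thesis using d xy unfolding D_def[symmetric] by (simp add: algebra_simps)
qed

lemma G_inj: "inj G"
proof (rule injI)
  fix x y assume "G x = G y"
  then show "x = y" using norm_le_G[of x y] by simp
qed

text \<open>\<open>G\<close> maps every line in direction \<open>j\<close> into itself, so the
  intermediate value theorem on one line suffices.\<close>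

lemma G_surj: "surj G"
proof -
  have "z \<in> range G" for z
  proof -
  define h where "h t = G (z + t *\<^sub>R j) \<bullet> j" for t
  have cont: "continuous_on UNIV h"
    unfolding h_def by (intro continuous_intros continuous_on_compose2[OF lipschitz_on_continuous_on[OF G_lipschitz[of UNIV]]]) auto
  have h: "h t = h 0 + t + (C * t + (g (z + t *\<^sub>R j) - g z))" for t
    using j by (simp add: h_def G_j algebra_simps)
  have hb: "\<bar>g (z + t *\<^sub>R j) - g z\<bar> \<le> C * \<bar>t\<bar>" for t
    using g_diff[of "z + t *\<^sub>R j" z] j by simp
  \<comment> \<open>Since \<open>C * t\<close> outweighs the change of \<open>g\<close>, going a
    distance \<open>w\<close> along the line moves \<open>h\<close> by at least \<open>w\<close>.
    The remaining facts only spell out arithmetic for \<open>linarith\<close>.\<close>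
  obtain w where w: "0 \<le> w" "\<bar>w\<bar> = w" "\<bar>-w\<bar> = w" "z \<bullet> j - h 0 \<le> w" "h 0 - z \<bullet> j \<le> w"
      "C * (- w) = - (C * w)"
    by (rule that[of "\<bar>z \<bullet> j - h 0\<bar>"]) auto
  have "h (- w) \<le> z \<bullet> j" "z \<bullet> j \<le> h w"
    using h[of w] h[of "-w"] hb[of w] hb[of "-w"] w by linarith+
  moreover have "-w \<le> w" using w by simp
  ultimately obtain t where t: "h t = z \<bullet> j"
    using IVT'[of h "-w" "z \<bullet> j" w] continuous_on_subset[OF cont] by blast
  have "G (z + t *\<^sub>R j) = z"
  proof (rule euclidean_eqI)
    fix b :: 'a assume b: "b \<in> Basis"
    show "G (z + t *\<^sub>R j) \<bullet> b = z \<bullet> b"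
    proof (cases "b = j")
      case True then show ?thesis using t by (simp add: h_def)
    next
      case False then show ?thesis using b j by (simp add: G_other inner_add_left inner_not_same_Basis)
    qed
  qed
  then show "z \<in> range G" by (metis rangeI)
  qed
  then show ?thesis by blast
qed

lemma G_bij: "bij G" using G_inj G_surj by (rule bijI)

section \<open>The volume of images under \<open>G\<close> and its density\<close>

lemma continuous_inv_G: "continuous_on UNIV (inv G)"
proof -
  have "(3 + 2 * C)-lipschitz_on UNIV (inv G)"
  proof (rule lipschitz_onI)
    fix x y
    show "dist (inv G x) (inv G y) \<le> (3 + 2 * C) * dist x y"
      using norm_le_G[of "inv G x" "inv G y"] by (simp add: dist_norm surj_f_inv_f[OF G_surj])
  qed (use C_nonneg in auto)
  then show ?thesis by (rule lipschitz_on_continuous_on)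
qed

text \<open>The volume of \<open>G\<close>-images, written as a push-forward along the inverse so
  that it is a measure by construction.\<close>

definition N :: "'a measure" where "N = distr lborel borel (inv G)"

lemma sets_N [simp]: "sets N = sets borel" by (simp add: N_def)

lemma G_image_borel: "B \<in> sets borel \<Longrightarrow> G ` B \<in> sets borel"
  using measurable_sets[OF borel_measurable_continuous_onI[OF continuous_inv_G], of B]
  by (simp add: bij_vimage_eq_inv_image[OF bij_imp_bij_inv[OF G_bij]] inv_inv_eq[OF G_bij])

lemma emeasure_N: "B \<in> sets borel \<Longrightarrow> emeasure N B = emeasure lborel (G ` B)"
  unfolding N_def using borel_measurable_continuous_onI[OF continuous_inv_G]
  by (subst emeasure_distr)
     (simp_all add: bij_vimage_eq_inv_image[OF bij_imp_bij_inv[OF G_bij]] inv_inv_eq[OF G_bij])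

text \<open>\<open>1 + 2 * C\<close> is the Lipschitz constant of \<open>G\<close>; the factor 10 is
  the loss in comparing content with volume.\<close>

definition M :: real where "M = (10 * (1 + 2 * C)) ^ DIM('a)"

lemma M_nonneg: "0 \<le> M" using C_nonneg by (simp add: M_def)

text \<open>Content scales correctly under Lipschitz maps and is comparable with volume in both
  directions; the two factors \<open>unit_ball_vol\<close> cancel.\<close>

lemma emeasure_N_le:
  assumes B: "B \<in> sets borel"
  shows "emeasure N B \<le> ennreal M * emeasure lborel B"
proof -
  let ?v = "unit_ball_vol DIM('a)"
  have v: "0 < ?v" by simp
  have "emeasure N B = emeasure lebesgue (G ` B)" using B G_image_borel by (simp add: emeasure_N)
  also have "\<dots> \<le> ennreal ?v * hausdorff_content DIM('a) (G ` B)"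
    by (rule emeasure_lebesgue_le_hausdorff_content) (simp add: B G_image_borel)
  also have "\<dots> \<le> ennreal ?v * (ennreal ((1 + 2 * C) ^ DIM('a)) * hausdorff_content DIM('a) B)"
    using C_nonneg by (intro mult_left_mono hausdorff_content_lipschitz_image G_lipschitz) auto
  also have "\<dots> \<le> ennreal ?v * (ennreal ((1 + 2 * C) ^ DIM('a)) * (ennreal (10 ^ DIM('a) / ?v) * emeasure lebesgue B))"
    by (intro mult_left_mono hausdorff_content_le_lebesgue) (use B in auto)
  also have "\<dots> = ennreal (?v * ((1 + 2 * C) ^ DIM('a) * (10 ^ DIM('a) / ?v))) * emeasure lebesgue B"
  proof -
    have "0 \<le> (1 + 2 * C) ^ DIM('a) * (10 ^ DIM('a) / ?v)" "0 \<le> 10 ^ DIM('a) / ?v"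
      using v C_nonneg by (auto intro!: mult_nonneg_nonneg divide_nonneg_pos)
    then show ?thesis by (simp only: ennreal_mult'' mult.assoc)
  qed
  also have "?v * ((1 + 2 * C) ^ DIM('a) * (10 ^ DIM('a) / ?v)) = M"
    using less_imp_neq[OF v, symmetric] unfolding M_def power_mult_distrib by simp
  finally show ?thesis using B by simp
qed

text \<open>The Radon-Nikodym density is finite almost everywhere because \<open>N\<close> is finite
  on balls; changing it on a null set gives a real-valued version, with which slopes can be
  computed.\<close>

lemma ex_density:
  obtains \<sigma> where "\<sigma> \<in> borel_measurable borel" "\<And>x. 0 \<le> \<sigma> x" "density lborel (\<lambda>x. ennreal (\<sigma> x)) = N"
proof -
  have "absolutely_continuous lborel N"
    unfolding absolutely_continuous_def null_sets_def
  proof safe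
    fix B :: "'a set" assume "B \<in> sets lborel" "emeasure lborel B = 0"
    then show "emeasure N B = 0" using emeasure_N_le[of B] by simp
  qed simp
  then obtain f where f: "f \<in> borel_measurable lborel" "density lborel f = N"
    using sigma_finite_measure.Radon_Nikodym[OF sigma_finite_lborel, of N] by auto
  have "AE x in lborel. \<forall>n::nat. f x * indicator (cball 0 n) x \<noteq> \<infinity>"
    unfolding AE_all_countable
  proof
    fix n :: nat
    have "(\<integral>\<^sup>+ x. f x * indicator (cball 0 n) x \<partial>lborel) = emeasure N (cball 0 n)"
      unfolding f(2)[symmetric] by (rule emeasure_density[symmetric]) (use f in auto)
    also have "\<dots> \<le> ennreal M * emeasure lborel (cball (0::'a) n)" by (rule emeasure_N_le) auto
    also have "\<dots> < \<infinity>" by (simp add: ennreal_mult_less_top emeasure_cball)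
    finally show "AE x in lborel. f x * indicator (cball 0 n) x \<noteq> \<infinity>"
      using f by (intro nn_integral_PInf_AE borel_measurable_times_ennreal borel_measurable_indicator) auto
  qed
  then have "AE x in lborel. f x \<noteq> \<infinity>"
  proof eventually_elim
    case (elim x)
    obtain n :: nat where "norm x \<le> n" using real_arch_simple by blast
    with elim[rule_format, of n] show ?case by simp
  qed
  then have "AE x in lborel. ennreal (enn2real (f x)) = f x"
    by eventually_elim (simp add: less_top)
  then have "density lborel (\<lambda>x. ennreal (enn2real (f x))) = density lborel f"
    using f by (intro density_cong) auto
  then show thesis using f by (intro that[of "\<lambda>x. enn2real (f x)"]) auto
qed

section \<open>Thin boxes and their images under \<open>G\<close>\<close>

definition slab :: "'a \<Rightarrow> real \<Rightarrow> real \<Rightarrow> real \<Rightarrow> 'a set" where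
  "slab y d a b = cbox (\<Sum>i\<in>Basis. (if i = j then a else y \<bullet> i - d) *\<^sub>R i)
                       (\<Sum>i\<in>Basis. (if i = j then b else y \<bullet> i + d) *\<^sub>R i)"

lemma mem_slab: "x \<in> slab y d a b \<longleftrightarrow> a \<le> x \<bullet> j \<and> x \<bullet> j \<le> b \<and> (\<forall>i\<in>Basis - {j}. \<bar>x \<bullet> i - y \<bullet> i\<bar> \<le> d)"
proof -
  have "x \<in> slab y d a b \<longleftrightarrow>
      (\<forall>i\<in>Basis. (if i = j then a else y \<bullet> i - d) \<le> x \<bullet> i \<and> x \<bullet> i \<le> (if i = j then b else y \<bullet> i + d))"
    by (simp add: slab_def mem_box)
  also have "\<dots> \<longleftrightarrow> (a \<le> x \<bullet> j \<and> x \<bullet> j \<le> b) \<and>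
      (\<forall>i\<in>Basis - {j}. y \<bullet> i - d \<le> x \<bullet> i \<and> x \<bullet> i \<le> y \<bullet> i + d)"
    using j by auto
  also have "(\<forall>i\<in>Basis - {j}. y \<bullet> i - d \<le> x \<bullet> i \<and> x \<bullet> i \<le> y \<bullet> i + d) \<longleftrightarrow>
      (\<forall>i\<in>Basis - {j}. \<bar>x \<bullet> i - y \<bullet> i\<bar> \<le> d)"
    by (intro ball_cong refl) (auto simp: abs_le_iff)
  finally show ?thesis by simp
qed

lemma measure_slab:
  assumes "a \<le> b" "0 \<le> d"
  shows "measure lborel (slab y d a b) = (2 * d) ^ (DIM('a) - 1) * (b - a)"
proof -
  have "measure lborel (slab y d a b) = (\<Prod>i\<in>Basis. (if i = j then b - a else 2 * d))"
    unfolding slab_def using assms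
    by (subst measure_lborel_cbox) (auto intro!: prod.cong simp: inner_diff_left)
  also have "\<dots> = (b - a) * (\<Prod>i\<in>Basis - {j}. (if i = j then b - a else 2 * d))"
    using j by (subst prod.remove[of _ j]) auto
  also have "(\<Prod>i\<in>Basis - {j}. (if i = j then b - a else 2 * d)) = (2 * d) ^ (DIM('a) - 1)"
    using j by (subst prod.cong[OF refl, of _ _ "\<lambda>_. 2 * d"]) auto
  finally show ?thesis by simp
qed

lemma slab_borel [simp]: "slab y d a b \<in> sets borel" by (simp add: slab_def)

lemma emeasure_slab_finite: "emeasure lborel (slab y d a b) < \<infinity>"
  by (simp add: slab_def emeasure_lborel_cbox_eq)

lemma slab_norm:
  fixes x y :: 'a and d :: real
  assumes x: "\<forall>i\<in>Basis - {j}. \<bar>x \<bullet> i - y \<bullet> i\<bar> \<le> d" and d: "0 \<le> d"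
  shows "norm (x - y) \<le> DIM('a) * d + \<bar>(x - y) \<bullet> j\<bar>"
proof -
  have "norm (x - y - ((x - y) \<bullet> j) *\<^sub>R j) \<le> DIM('a) * d"
    using assms j by (intro norm_le_DIM_mult) (auto simp: inner_diff_left inner_Basis)
  then show ?thesis
    using norm_triangle_ineq[of "x - y - ((x - y) \<bullet> j) *\<^sub>R j" "((x - y) \<bullet> j) *\<^sub>R j"] j by simp
qed

text \<open>\<open>\<alpha>\<close> and \<open>\<beta>\<close> are the \<open>j\<close>-coordinates
  of \<open>G\<close> at the two ends \<open>y\<close> and \<open>y + t *\<^sub>R j\<close> of the
  axis of the box. \<open>G\<close> keeps the other coordinates, and across the width
  \<open>d\<close> the function \<open>g\<close> varies by at most \<open>e\<close>. So the image is
  a box with slightly uneven ends, caught between two exact boxes.\<close>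

lemma G_image_slab_bounds:
  fixes y :: 'a and t d :: real
  assumes t: "0 \<le> t" and d: "0 \<le> d"
  defines "\<alpha> \<equiv> (1 + C) * (y \<bullet> j) + g y" and "\<beta> \<equiv> (1 + C) * (y \<bullet> j + t) + g (y + t *\<^sub>R j)"
    and "e \<equiv> C * (DIM('a) * d)"
  shows "G ` slab y d (y \<bullet> j) (y \<bullet> j + t) \<subseteq> slab y d (\<alpha> - e) (\<beta> + e)"
    and "slab y d (\<alpha> + e) (\<beta> - e) \<subseteq> G ` slab y d (y \<bullet> j) (y \<bullet> j + t)"
proof -
  have dev: "\<bar>g x - g y\<bar> \<le> e + C * \<bar>x \<bullet> j - y \<bullet> j\<bar>"
       "\<bar>g x - g (y + t *\<^sub>R j)\<bar> \<le> e + C * \<bar>x \<bullet> j - y \<bullet> j - t\<bar>"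
    if x: "\<forall>i\<in>Basis - {j}. \<bar>x \<bullet> i - y \<bullet> i\<bar> \<le> d" for x
  proof -
    show "\<bar>g x - g y\<bar> \<le> e + C * \<bar>x \<bullet> j - y \<bullet> j\<bar>"
      using g_diff[of x y] mult_left_mono[OF slab_norm[OF x d] C_nonneg]
      by (simp add: e_def distrib_left inner_diff_left)
    have x': "\<forall>i\<in>Basis - {j}. \<bar>x \<bullet> i - (y + t *\<^sub>R j) \<bullet> i\<bar> \<le> d"
    proof
      fix i assume i: "i \<in> Basis - {j}"
      then have "j \<bullet> i = 0" using j by (auto intro: inner_not_same_Basis)
      then show "\<bar>x \<bullet> i - (y + t *\<^sub>R j) \<bullet> i\<bar> \<le> d" using x i by (simp add: inner_add_left)
    qed
    show "\<bar>g x - g (y + t *\<^sub>R j)\<bar> \<le> e + C * \<bar>x \<bullet> j - y \<bullet> j - t\<bar>"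
      using g_diff[of x "y + t *\<^sub>R j"] mult_left_mono[OF slab_norm[OF x' d] C_nonneg] j
      by (simp add: e_def distrib_left inner_diff_left inner_add_left algebra_simps)
  qed
  show "G ` slab y d (y \<bullet> j) (y \<bullet> j + t) \<subseteq> slab y d (\<alpha> - e) (\<beta> + e)"
  proof safe
    fix x assume "x \<in> slab y d (y \<bullet> j) (y \<bullet> j + t)"
    then have x: "y \<bullet> j \<le> x \<bullet> j" "x \<bullet> j \<le> y \<bullet> j + t" "\<forall>i\<in>Basis - {j}. \<bar>x \<bullet> i - y \<bullet> i\<bar> \<le> d"
      by (auto simp: mem_slab)
    have "\<alpha> - e \<le> G x \<bullet> j" "G x \<bullet> j \<le> \<beta> + e"
      using dev[OF x(3)] x(1,2) unfolding G_j \<alpha>_def \<beta>_def by (auto simp: algebra_simps)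
    then show "G x \<in> slab y d (\<alpha> - e) (\<beta> + e)"
      using x(3) by (auto simp: mem_slab G_other)
  qed
  show "slab y d (\<alpha> + e) (\<beta> - e) \<subseteq> G ` slab y d (y \<bullet> j) (y \<bullet> j + t)"
  proof
    fix w assume w: "w \<in> slab y d (\<alpha> + e) (\<beta> - e)"
    obtain x where wx: "w = G x" using G_surj by blast
    have x3: "\<forall>i\<in>Basis - {j}. \<bar>x \<bullet> i - y \<bullet> i\<bar> \<le> d"
      using w by (auto simp: mem_slab wx G_other)
    have w12: "\<alpha> + e \<le> (1 + C) * (x \<bullet> j) + g x" "(1 + C) * (x \<bullet> j) + g x \<le> \<beta> - e"
      using w by (auto simp: mem_slab wx G_j)
    have "y \<bullet> j \<le> x \<bullet> j"
    proof (rule ccontr)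
      assume "\<not> ?thesis"
      then show False using dev(1)[OF x3] w12(1) unfolding \<alpha>_def by (simp add: algebra_simps)
    qed
    moreover have "x \<bullet> j \<le> y \<bullet> j + t"
    proof (rule ccontr)
      assume "\<not> ?thesis"
      then show False using dev(2)[OF x3] w12(2) unfolding \<beta>_def by (simp add: algebra_simps)
    qed
    ultimately show "w \<in> G ` slab y d (y \<bullet> j) (y \<bullet> j + t)"
      using x3 wx by (auto simp: mem_slab)
  qed
qed

text \<open>The enclosing and the enclosed box have lengths
  \<open>\<beta> - \<alpha> + 2 * e\<close> and \<open>\<beta> - \<alpha> - 2 * e\<close> and the
  same cross-section. So the volume of the image measures the increment of \<open>g\<close> along
  the axis.\<close>

lemma measure_G_slab:
  fixes y :: 'a and t d :: real
  assumes t: "0 \<le> t" and d: "0 \<le> d"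
  shows "\<bar>measure N (slab y d (y \<bullet> j) (y \<bullet> j + t)) -
      (2 * d) ^ (DIM('a) - 1) * (g (y + t *\<^sub>R j) - g y + (1 + C) * t)\<bar>
    \<le> (2 * d) ^ (DIM('a) - 1) * (2 * C * (DIM('a) * d))"
proof -
  define \<alpha> where "\<alpha> = (1 + C) * (y \<bullet> j) + g y"
  define \<beta> where "\<beta> = (1 + C) * (y \<bullet> j + t) + g (y + t *\<^sub>R j)"
  define e where "e = C * (DIM('a) * d)"
  define q where "q = (2 * d) ^ (DIM('a) - 1)"
  let ?Q = "slab y d (y \<bullet> j) (y \<bullet> j + t)"
  have e: "0 \<le> e" using C_nonneg d by (simp add: e_def)
  have q: "0 \<le> q" using d by (simp add: q_def)
  have ab: "\<beta> - \<alpha> = g (y + t *\<^sub>R j) - g y + (1 + C) * t"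
    by (simp add: \<alpha>_def \<beta>_def algebra_simps)
  have ab0: "\<alpha> \<le> \<beta>"
    using g_diff[of "y + t *\<^sub>R j" y] t j unfolding \<alpha>_def \<beta>_def by (simp add: algebra_simps)
  have NQ: "measure N ?Q = measure lborel (G ` ?Q)"
    by (simp add: measure_def emeasure_N)
  have sub: "G ` ?Q \<subseteq> slab y d (\<alpha> - e) (\<beta> + e)" "slab y d (\<alpha> + e) (\<beta> - e) \<subseteq> G ` ?Q"
    using G_image_slab_bounds[OF t d] unfolding \<alpha>_def \<beta>_def e_def by auto
  have fin: "emeasure lborel (G ` ?Q) < \<infinity>"
    using emeasure_mono[OF sub(1), of lborel] emeasure_slab_finite by (simp add: le_less_trans)
  have "measure lborel (G ` ?Q) \<le> measure lborel (slab y d (\<alpha> - e) (\<beta> + e))"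
    using sub(1) emeasure_slab_finite by (intro measure_mono_fmeasurable)
      (auto simp: fmeasurable_def G_image_borel)
  also have "\<dots> = q * (\<beta> - \<alpha> + 2 * e)"
    using ab0 e d by (subst measure_slab) (auto simp: q_def algebra_simps)
  finally have up: "measure N ?Q - q * (\<beta> - \<alpha>) \<le> q * (2 * e)" using NQ by (simp add: algebra_simps)
  \<comment> \<open>If the inner box degenerates, the bound is not positive and hence
    trivial.\<close>
  have lo: "q * (\<beta> - \<alpha> - 2 * e) \<le> measure N ?Q"
  proof (cases "\<alpha> + e \<le> \<beta> - e")
    case True
    have "q * (\<beta> - \<alpha> - 2 * e) = measure lborel (slab y d (\<alpha> + e) (\<beta> - e))"
      using True d by (subst measure_slab) (auto simp: q_def algebra_simps)
    also have "\<dots> \<le> measure lborel (G ` ?Q)"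
      using sub(2) fin by (intro measure_mono_fmeasurable)
        (auto simp: fmeasurable_def G_image_borel)
    finally show ?thesis using NQ by simp
  next
    case False
    then have "q * (\<beta> - \<alpha> - 2 * e) \<le> 0" using q by (intro mult_nonneg_nonpos) auto
    then show ?thesis using measure_nonneg order_trans by blast
  qed
  have "\<bar>measure N ?Q - q * (\<beta> - \<alpha>)\<bar> \<le> q * (2 * e)"
    using up lo by (simp add: algebra_simps abs_le_iff)
  then show ?thesis unfolding ab q_def e_def by (simp add: mult.assoc)
qed

end

section \<open>From density points to slopes\<close>

lemma negligible_UN_countable:
  assumes "countable I" "\<And>i. i \<in> I \<Longrightarrow> negligible (A i)"
  shows "negligible (\<Union>i\<in>I. A i)"
  by (rule negligible_countable_Union) (use assms in auto)

lemma full_density_scaled: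
  fixes x :: "'a::euclidean_space" and c e :: real
  assumes A: "A \<in> sets borel" "full_density A x" and c: "0 < c" and e: "0 < e"
  obtains \<delta> where "0 < \<delta>" "\<And>r. 0 < r \<Longrightarrow> r < \<delta> \<Longrightarrow>
    emeasure lborel (cball x (c * r) - A) \<le> ennreal (e * r ^ DIM('a))"
proof -
  have "0 < e / c ^ DIM('a)" using c e by simp
  then obtain \<delta> where \<delta>: "0 < \<delta>" "\<And>r. 0 < r \<Longrightarrow> r < \<delta> \<Longrightarrow>
      emeasure lebesgue (cball x r - A) \<le> ennreal (e / c ^ DIM('a) * r ^ DIM('a))"
    using A(2) unfolding full_density_def by blast
  show thesis
  proof
    show "0 < \<delta> / c" using \<delta> c by simp
    fix r assume r: "0 < r" "r < \<delta> / c"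
    have "c * r < \<delta>" using r c by (simp add: field_simps)
    then have "emeasure lebesgue (cball x (c * r) - A) \<le> ennreal (e / c ^ DIM('a) * (c * r) ^ DIM('a))"
      using \<delta>(2)[of "c * r"] r c by simp
    also have "e / c ^ DIM('a) * (c * r) ^ DIM('a) = e * r ^ DIM('a)"
      using c by (simp add: power_mult_distrib)
    finally show "emeasure lborel (cball x (c * r) - A) \<le> ennreal (e * r ^ DIM('a))"
      using A(1) by simp
  qed
qed

text \<open>The base point \<open>y\<close> ranges over a whole ball, and the error is relative to
  \<open>r\<close>, not to \<open>t\<close>. The freedom in \<open>y\<close> lets increments in
  different coordinate directions be added up and, by interchanging the end points, covers steps in
  the negative direction.\<close>

definition uniform_slope :: "('a::euclidean_space \<Rightarrow> real) \<Rightarrow> 'a \<Rightarrow> 'a \<Rightarrow> real \<Rightarrow> bool" where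
  "uniform_slope g j x p \<longleftrightarrow> (\<forall>e>0. \<exists>\<delta>>0. \<forall>r. 0 < r \<and> r < \<delta> \<longrightarrow>
     (\<forall>y\<in>cball x r. \<forall>t\<in>{0..r}. \<bar>g (y + t *\<^sub>R j) - g y - p * t\<bar> \<le> e * r))"

context lipschitz_stretch
begin

text \<open>The \<open>N\<close>-measure of a box over the segment from \<open>y\<close> to
  \<open>y + t *\<^sub>R j\<close> is computed twice. By \<open>measure_G_slab\<close> it is the
  cross-section \<open>q\<close> times \<open>g (y + t *\<^sub>R j) - g y + (1 + C) * t\<close>, up
  to an error from the width. By the density it is nearly \<open>p * (q * t)\<close>. In the final
  constant, \<open>1\<close> comes from the deviation of \<open>\<sigma>\<close> from
  \<open>p\<close> on \<open>A\<close>, \<open>2 * C * DIM('a)\<close> from the width, and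
  \<open>M + p\<close> from the part of the box outside \<open>A\<close>, where only
  \<open>emeasure_N_le\<close> is available.\<close>

lemma increment_estimate:
  fixes x y :: 'a and p \<epsilon> r t :: real
  assumes \<sigma>: "\<sigma> \<in> borel_measurable borel" "\<And>x. 0 \<le> \<sigma> x" "density lborel (\<lambda>x. ennreal (\<sigma> x)) = N"
    and A: "A \<in> sets borel" "\<And>z. z \<in> A \<Longrightarrow> \<bar>\<sigma> z - p\<bar> \<le> \<epsilon>"
    and pos: "0 \<le> p" "0 < \<epsilon>" "\<epsilon> \<le> 1" "0 < r"
    and dens: "emeasure lborel (cball x ((DIM('a) + 2) * r) - A) \<le> ennreal (\<epsilon> * (2 * (\<epsilon> * r)) ^ (DIM('a) - 1) * r)"
    and y: "y \<in> cball x r" and t: "0 \<le> t" "t \<le> r"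
  shows "\<bar>g (y + t *\<^sub>R j) - g y - (p - 1 - C) * t\<bar> \<le> (1 + 2 * C * DIM('a) + M + p) * (\<epsilon> * r)"
proof -
  \<comment> \<open>With half-width \<open>\<epsilon> * r\<close> the error from the width is of
    order \<open>\<epsilon> * r\<close> after division by \<open>q\<close>, while the box still has
    enough volume for \<open>dens\<close> to be usable.\<close>
  define d where "d = \<epsilon> * r"
  define q where "q = (2 * d) ^ (DIM('a) - 1)"
  define Q where "Q = slab y d (y \<bullet> j) (y \<bullet> j + t)"
  have d: "0 < d" "d \<le> r" using pos by (auto simp: d_def)
  have q: "0 < q" using d by (simp add: q_def)
  have Qb [measurable]: "Q \<in> sets borel" by (simp add: Q_def)
  note A(1) [measurable]
  have Qfin: "emeasure lborel Q < \<infinity>" unfolding Q_def by (rule emeasure_slab_finite)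
  have NQfin: "emeasure N Q < \<infinity>"
    using emeasure_N_le[OF Qb] Qfin by (auto simp: ennreal_mult_less_top intro: le_less_trans)
  have mQ: "measure lborel Q = q * t"
    unfolding Q_def using d t by (subst measure_slab) (auto simp: q_def)
  \<comment> \<open>A point of the box is within \<open>DIM('a) * r + r\<close> of \<open>y\<close>,
    and \<open>y\<close> is within \<open>r\<close> of \<open>x\<close>; this explains the radius in
    \<open>dens\<close>.\<close>
  have Qsub: "Q \<subseteq> cball x ((DIM('a) + 2) * r)"
  proof
    fix z assume z: "z \<in> Q"
    then have "norm (z - y) \<le> DIM('a) * d + \<bar>(z - y) \<bullet> j\<bar>"
      using d by (intro slab_norm) (auto simp: Q_def mem_slab)
    also have "\<dots> \<le> DIM('a) * r + r"
      using z d t by (intro add_mono mult_left_mono) (auto simp: Q_def mem_slab inner_diff_left)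
    finally show "z \<in> cball x ((DIM('a) + 2) * r)"
      using y dist_triangle[of x z y] by (simp add: dist_norm norm_minus_commute algebra_simps)
  qed
  define m1 where "m1 = measure lborel (Q \<inter> A)"
  define m2 where "m2 = measure lborel (Q - A)"
  define n1 where "n1 = measure N (Q \<inter> A)"
  define n2 where "n2 = measure N (Q - A)"
  have f1: "emeasure lborel (Q \<inter> A) = ennreal m1"
    unfolding m1_def using Qfin emeasure_mono[of "Q \<inter> A" Q lborel]
    by (intro emeasure_eq_ennreal_measure) (auto simp: top_unique)
  have f2: "emeasure lborel (Q - A) = ennreal m2"
    unfolding m2_def using Qfin emeasure_mono[of "Q - A" Q lborel]
    by (intro emeasure_eq_ennreal_measure) (auto simp: top_unique)
  have g1: "emeasure N (Q \<inter> A) = ennreal n1"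
    unfolding n1_def using NQfin emeasure_mono[of "Q \<inter> A" Q N]
    by (intro emeasure_eq_ennreal_measure) (auto simp: top_unique)
  have g2: "emeasure N (Q - A) = ennreal n2"
    unfolding n2_def using NQfin emeasure_mono[of "Q - A" Q N]
    by (intro emeasure_eq_ennreal_measure) (auto simp: top_unique)
  have nn: "0 \<le> m1" "0 \<le> m2" "0 \<le> n1" "0 \<le> n2" by (auto simp: m1_def m2_def n1_def n2_def)
  have "emeasure lborel (Q \<inter> A) + emeasure lborel (Q - A) = emeasure lborel Q"
    by (subst plus_emeasure) (auto simp: Int_Diff_Un)
  then have m: "m1 + m2 = q * t"
    unfolding mQ[symmetric] measure_def f1 f2 using nn by (metis enn2real_ennreal ennreal_plus add_nonneg_nonneg)
  have "emeasure N (Q \<inter> A) + emeasure N (Q - A) = emeasure N Q"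
    by (subst plus_emeasure) (auto simp: Int_Diff_Un)
  then have n: "n1 + n2 = measure N Q"
    unfolding measure_def g1 g2 using nn by (metis enn2real_ennreal ennreal_plus add_nonneg_nonneg)
  have "ennreal m2 \<le> ennreal (\<epsilon> * q * r)"
    unfolding f2[symmetric] q_def d_def
    by (rule order_trans[OF emeasure_mono dens]) (use Qsub in auto)
  then have m2: "m2 \<le> \<epsilon> * q * r" using pos q by (simp add: ennreal_le_iff)
  have "ennreal n2 \<le> ennreal (M * m2)"
    using emeasure_N_le[of "Q - A"] f2 g2 M_nonneg by (simp add: ennreal_mult')
  then have n2: "n2 \<le> M * m2" using M_nonneg nn by (simp add: ennreal_le_iff)
  have N_int: "emeasure N (Q \<inter> A) = (\<integral>\<^sup>+ z. ennreal (\<sigma> z) * indicator (Q \<inter> A) z \<partial>lborel)"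
    unfolding \<sigma>(3)[symmetric] by (rule emeasure_density) (use \<sigma>(1) in auto)
  have "ennreal n1 \<le> (\<integral>\<^sup>+ z. ennreal (p + \<epsilon>) * indicator (Q \<inter> A) z \<partial>lborel)"
    unfolding g1[symmetric] N_int
    by (intro nn_integral_mono) (use A(2) in \<open>auto simp: indicator_def abs_le_iff algebra_simps intro!: ennreal_leI\<close>)
  also have "\<dots> = ennreal ((p + \<epsilon>) * m1)"
    using pos nn by (subst nn_integral_cmult_indicator) (auto simp: f1 ennreal_mult' simp del: ennreal_plus)
  finally have up: "n1 \<le> (p + \<epsilon>) * m1" using pos nn by (simp add: ennreal_le_iff)
  have lo: "(p - \<epsilon>) * m1 \<le> n1"
  proof (cases "p \<le> \<epsilon>")
    case True
    then have "(p - \<epsilon>) * m1 \<le> 0" using nn by (intro mult_nonpos_nonneg) auto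
    then show ?thesis using nn by linarith
  next
    case False
    have "ennreal ((p - \<epsilon>) * m1) = (\<integral>\<^sup>+ z. ennreal (p - \<epsilon>) * indicator (Q \<inter> A) z \<partial>lborel)"
      using False nn by (subst nn_integral_cmult_indicator) (auto simp: f1 ennreal_mult')
    also have "\<dots> \<le> ennreal n1"
      unfolding g1[symmetric] N_int
      by (intro nn_integral_mono) (use A(2) in \<open>auto simp: indicator_def abs_le_iff algebra_simps intro!: ennreal_leI\<close>)
    finally show ?thesis using nn by (simp add: ennreal_le_iff)
  qed
  define \<Delta> where "\<Delta> = g (y + t *\<^sub>R j) - g y"
  have slab: "\<bar>n1 + n2 - q * (\<Delta> + (1 + C) * t)\<bar> \<le> q * (2 * C * (DIM('a) * d))"
    unfolding n q_def \<Delta>_def Q_def using d t by (intro measure_G_slab) auto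
  have pm2: "0 \<le> p * m2" using pos nn by simp
  have Mm2: "(M + p) * m2 \<le> (M + p) * (\<epsilon> * q * r)" using m2 M_nonneg pos by (intro mult_left_mono) auto
  have em1: "\<epsilon> * m1 \<le> \<epsilon> * (q * r)"
    using m nn t q pos by (intro mult_left_mono) (auto intro: order_trans[of _ "q * t"])
  have pm: "p * m1 + p * m2 = p * (q * t)" by (simp add: m distrib_left[symmetric])
  have "\<bar>n1 + n2 - p * (q * t)\<bar> \<le> \<epsilon> * m1 + (M + p) * m2"
    using up lo n2 pm pm2 nn unfolding abs_le_iff distrib_right left_diff_distrib by linarith
  then have "\<bar>q * (\<Delta> + (1 + C) * t) - p * (q * t)\<bar> \<le> q * (2 * C * (DIM('a) * d)) + \<epsilon> * (q * r) + (M + p) * (\<epsilon> * q * r)"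
    using slab Mm2 em1 by linarith
  also have "q * (\<Delta> + (1 + C) * t) - p * (q * t) = q * (\<Delta> - (p - 1 - C) * t)"
    by (simp add: algebra_simps)
  also have "q * (2 * C * (DIM('a) * d)) + \<epsilon> * (q * r) + (M + p) * (\<epsilon> * q * r)
      = q * ((1 + 2 * C * DIM('a) + M + p) * (\<epsilon> * r))"
    by (simp add: d_def algebra_simps)
  finally have "q * \<bar>\<Delta> - (p - 1 - C) * t\<bar> \<le> q * ((1 + 2 * C * DIM('a) + M + p) * (\<epsilon> * r))"
    using q by (simp add: abs_mult)
  then show ?thesis using q unfolding \<Delta>_def by (simp add: mult_le_cancel_left_pos)
qed

lemma increment_estimate_small:
  fixes x :: 'a and p \<epsilon> :: real
  assumes \<sigma>: "\<sigma> \<in> borel_measurable borel" "\<And>x. 0 \<le> \<sigma> x" "density lborel (\<lambda>x. ennreal (\<sigma> x)) = N"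
    and A: "A \<in> sets borel" "\<And>z. z \<in> A \<Longrightarrow> \<bar>\<sigma> z - p\<bar> \<le> \<epsilon>" "full_density A x"
    and pos: "0 \<le> p" "0 < \<epsilon>" "\<epsilon> \<le> 1"
  shows "\<exists>\<delta>>0. \<forall>r. 0 < r \<and> r < \<delta> \<longrightarrow> (\<forall>y\<in>cball x r. \<forall>t\<in>{0..r}.
    \<bar>g (y + t *\<^sub>R j) - g y - (p - 1 - C) * t\<bar> \<le> (1 + 2 * C * DIM('a) + M + p) * (\<epsilon> * r))"
proof -
  \<comment> \<open>For fixed \<open>\<epsilon>\<close> the cross-section scales like
    \<open>r ^ (DIM('a) - 1)\<close>, so the bound demanded by \<open>increment_estimate\<close> is
    a fixed multiple of \<open>r ^ DIM('a)\<close>, as density at \<open>x\<close> provides.\<close>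
  define \<eta> where "\<eta> = \<epsilon> * (2 * \<epsilon>) ^ (DIM('a) - 1)"
  have \<eta>: "0 < \<eta>" using pos by (simp add: \<eta>_def)
  obtain \<delta> where \<delta>: "0 < \<delta>" "\<And>r::real. 0 < r \<Longrightarrow> r < \<delta> \<Longrightarrow>
      emeasure lborel (cball x ((DIM('a) + 2) * r) - A) \<le> ennreal (\<eta> * r ^ DIM('a))"
    using full_density_scaled[OF A(1,3) _ \<eta>, of "real (DIM('a) + 2)"]
    by (metis of_nat_0_less_iff add_2_eq_Suc' zero_less_Suc)
  have eq: "\<eta> * r ^ DIM('a) = \<epsilon> * (2 * (\<epsilon> * r)) ^ (DIM('a) - 1) * r" for r :: real
    using power_minus_mult[of "DIM('a)" r] by (simp add: \<eta>_def power_mult_distrib mult_ac)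
  have "\<bar>g (y + t *\<^sub>R j) - g y - (p - 1 - C) * t\<bar> \<le> (1 + 2 * C * DIM('a) + M + p) * (\<epsilon> * r)"
    if "0 < r" "r < \<delta>" "y \<in> cball x r" "t \<in> {0..r}" for r y t
    using increment_estimate[OF \<sigma> A(1,2) pos that(1) \<delta>(2)[OF that(1,2), unfolded eq] that(3)] that(4)
    by auto
  with \<delta>(1) show ?thesis by blast
qed

text \<open>Approximate continuity of \<open>\<sigma>\<close> through countably many sets: almost
  every \<open>x\<close> is a density point of each preimage of a rational interval that contains
  it, and rational bounds can be chosen arbitrarily close to \<open>\<sigma> x\<close>.\<close>

lemma negligible_not_uniform_slope:
  assumes \<sigma>: "\<sigma> \<in> borel_measurable borel" "\<And>x. 0 \<le> \<sigma> x" "density lborel (\<lambda>x. ennreal (\<sigma> x)) = N"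
  shows "negligible {x. \<not> uniform_slope g j x (\<sigma> x - 1 - C)}"
proof -
  define A where "A = (\<lambda>(a, b). {x. \<sigma> x \<in> {a..b}})"
  have Ab: "A ab \<in> sets borel" for ab
    using measurable_sets[OF \<sigma>(1), of "{fst ab..snd ab}"] by (simp add: A_def vimage_def case_prod_unfold)
  have "negligible (\<Union>ab\<in>\<rat> \<times> \<rat>. {x \<in> A ab. \<not> full_density (A ab) x})"
    by (intro negligible_UN_countable) (auto intro!: Lebesgue_density countable_SIGMA countable_rat simp: Ab)
  moreover have "{x. \<not> uniform_slope g j x (\<sigma> x - 1 - C)} \<subseteq> (\<Union>ab\<in>\<rat> \<times> \<rat>. {x \<in> A ab. \<not> full_density (A ab) x})"
  proof (rule subsetI, rule ccontr)
    fix x assume x: "x \<in> {x. \<not> uniform_slope g j x (\<sigma> x - 1 - C)}"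
      and nx: "x \<notin> (\<Union>ab\<in>\<rat> \<times> \<rat>. {x \<in> A ab. \<not> full_density (A ab) x})"
    have "uniform_slope g j x (\<sigma> x - 1 - C)"
      unfolding uniform_slope_def
    proof (intro allI impI)
      fix e :: real assume e: "0 < e"
      \<comment> \<open>The constant of the increment estimate for \<open>p = \<sigma> x\<close>. It
        depends on \<open>x\<close>, so \<open>\<epsilon>\<close> is chosen only after
        \<open>x\<close>.\<close>
      define K where "K = 1 + 2 * C * DIM('a) + M + \<sigma> x"
      have K: "0 < K" using C_nonneg M_nonneg \<sigma>(2)[of x] by (simp add: K_def add_pos_nonneg)
      define \<epsilon> where "\<epsilon> = min 1 (e / K)"
      have \<epsilon>: "0 < \<epsilon>" "\<epsilon> \<le> 1" "K * \<epsilon> \<le> e"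
        using e K by (auto simp: \<epsilon>_def min_def field_simps)
      obtain a where a: "a \<in> \<rat>" "\<sigma> x - \<epsilon> < a" "a < \<sigma> x" using Rats_dense_in_real[of "\<sigma> x - \<epsilon>" "\<sigma> x"] \<epsilon> by auto
      obtain b where b: "b \<in> \<rat>" "\<sigma> x < b" "b < \<sigma> x + \<epsilon>" using Rats_dense_in_real[of "\<sigma> x" "\<sigma> x + \<epsilon>"] \<epsilon> by auto
      have "x \<in> A (a, b)" using a b by (simp add: A_def)
      then have fd: "full_density (A (a, b)) x" using nx a b by blast
      have "\<exists>\<delta>>0. \<forall>r. 0 < r \<and> r < \<delta> \<longrightarrow> (\<forall>y\<in>cball x r. \<forall>t\<in>{0..r}.
          \<bar>g (y + t *\<^sub>R j) - g y - (\<sigma> x - 1 - C) * t\<bar> \<le> K * (\<epsilon> * r))"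
        unfolding K_def
      proof (rule increment_estimate_small[OF \<sigma> Ab _ fd \<sigma>(2) \<epsilon>(1,2)])
        fix z assume "z \<in> A (a, b)"
        then show "\<bar>\<sigma> z - \<sigma> x\<bar> \<le> \<epsilon>" using a b by (auto simp: A_def)
      qed
      then obtain \<delta> where \<delta>: "0 < \<delta>" "\<And>r y t. 0 < r \<Longrightarrow> r < \<delta> \<Longrightarrow> y \<in> cball x r \<Longrightarrow> t \<in> {0..r} \<Longrightarrow>
          \<bar>g (y + t *\<^sub>R j) - g y - (\<sigma> x - 1 - C) * t\<bar> \<le> K * (\<epsilon> * r)" by blast
      have "K * (\<epsilon> * r) \<le> e * r" if "0 < r" for r
        using mult_right_mono[OF \<epsilon>(3), of r] that by (simp add: mult.assoc)
      then show "\<exists>\<delta>>0. \<forall>r. 0 < r \<and> r < \<delta> \<longrightarrow> (\<forall>y\<in>cball x r. \<forall>t\<in>{0..r}.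
          \<bar>g (y + t *\<^sub>R j) - g y - (\<sigma> x - 1 - C) * t\<bar> \<le> e * r)"
        using \<delta> by (meson order_trans)
    qed
    with x show False by simp
  qed
  ultimately show ?thesis by (rule negligible_subset)
qed

end

section \<open>Rademacher's theorem\<close>

text \<open>The point \<open>x + h\<close> is reached from \<open>x\<close> by changing one
  coordinate at a time. The intermediate points differ from \<open>x\<close>, which is why slopes at
  varying base points are required.\<close>

lemma has_derivative_if_uniform_slope:
  fixes g :: "'a::euclidean_space \<Rightarrow> real"
  assumes slope: "\<And>b. b \<in> Basis \<Longrightarrow> uniform_slope g b x (p b)"
  shows "(g has_derivative (\<lambda>h. (\<Sum>b\<in>Basis. p b *\<^sub>R b) \<bullet> h)) (at x)"
  unfolding has_derivative_at_alt
proof (intro conjI allI impI)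
  show "bounded_linear (\<lambda>h. (\<Sum>b\<in>Basis. p b *\<^sub>R b) \<bullet> h)" by (rule bounded_linear_inner_right)
  fix e :: real assume e: "0 < e"
  define k where "k = real DIM('a)"
  have k: "1 \<le> k" unfolding k_def using DIM_positive[where 'a='a] by linarith
  \<comment> \<open>There are \<open>k\<close> steps, each with error
    \<open>e' * R = e' * k * norm h\<close>, which add up to \<open>e * norm h\<close>.\<close>
  define e' where "e' = e / (k * k)"
  have e': "0 < e'" using e k by (simp add: e'_def)
  have "\<forall>b\<in>Basis. \<exists>\<delta>>0. \<forall>r. 0 < r \<and> r < \<delta> \<longrightarrow>
     (\<forall>y\<in>cball x r. \<forall>t\<in>{0..r}. \<bar>g (y + t *\<^sub>R b) - g y - p b * t\<bar> \<le> e' * r)"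
    using slope e' unfolding uniform_slope_def by blast
  then obtain D where D: "\<And>b. b \<in> Basis \<Longrightarrow> 0 < D b"
      "\<And>b r y t. b \<in> Basis \<Longrightarrow> 0 < r \<Longrightarrow> r < D b \<Longrightarrow> y \<in> cball x r \<Longrightarrow> t \<in> {0..r} \<Longrightarrow>
        \<bar>g (y + t *\<^sub>R b) - g y - p b * t\<bar> \<le> e' * r"
    by metis
  define \<delta> where "\<delta> = Min (D ` Basis)"
  have \<delta>: "0 < \<delta>" "\<And>b. b \<in> Basis \<Longrightarrow> \<delta> \<le> D b" using D(1) by (auto simp: \<delta>_def)
  show "\<exists>d>0. \<forall>y. norm (y - x) < d \<longrightarrow> norm (g y - g x - (\<Sum>b\<in>Basis. p b *\<^sub>R b) \<bullet> (y - x)) \<le> e * norm (y - x)"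
  proof (intro exI[of _ "\<delta> / k"] conjI allI impI)
    show "0 < \<delta> / k" using \<delta> k by simp
    fix y assume y: "norm (y - x) < \<delta> / k"
    define h where "h = y - x"
    \<comment> \<open>A partial sum of at most \<open>k\<close> coordinate components of
      \<open>h\<close> has norm at most \<open>k * norm h\<close>, so all intermediate points stay
      in \<open>cball x R\<close>.\<close>
    define R where "R = k * norm h"
    show "norm (g y - g x - (\<Sum>b\<in>Basis. p b *\<^sub>R b) \<bullet> (y - x)) \<le> e * norm (y - x)"
    proof (cases "h = 0")
      case True
      then show ?thesis by (simp add: h_def)
    next
      case False
      then have R: "0 < R" "R < \<delta>" "norm h \<le> R"
        using y k by (auto simp: R_def h_def field_simps mult_le_cancel_right1)
      define P where "P S = (\<Sum>b\<in>S. (h \<bullet> b) *\<^sub>R b)" for S :: "'a set"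
      have P: "norm (P S) \<le> R" if "S \<subseteq> Basis" for S
      proof -
        have "norm (P S) \<le> (\<Sum>b\<in>S. norm h)"
          unfolding P_def by (rule sum_norm_le) (use that in \<open>auto simp: Basis_le_norm\<close>)
        also have "\<dots> \<le> (\<Sum>b\<in>(Basis::'a set). norm h)" using that by (intro sum_mono2) auto
        finally show ?thesis by (simp add: R_def k_def)
      qed
      have "\<bar>g (x + P S) - g x - (\<Sum>b\<in>S. p b * (h \<bullet> b))\<bar> \<le> card S * (e' * R)" if "S \<subseteq> Basis" for S
        using finite_subset[OF that finite_Basis] that
      proof (induction S rule: finite_induct)
        case (insert c S)
        define t where "t = h \<bullet> c"
        have c: "c \<in> Basis" and S: "S \<subseteq> Basis" using insert.prems by auto
        have t: "\<bar>t\<bar> \<le> R" using Basis_le_norm[OF c, of h] R by (simp add: t_def)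
        have Pc: "P (insert c S) = P S + t *\<^sub>R c" using insert.hyps by (simp add: P_def t_def)
        have in1: "x + P S \<in> cball x R" "x + P (insert c S) \<in> cball x R"
          using P[OF S] P[OF insert.prems] by (auto simp: dist_norm)
        have "\<bar>g (x + P (insert c S)) - g (x + P S) - p c * t\<bar> \<le> e' * R"
        proof (cases "0 \<le> t")
          case True
          show ?thesis
            using D(2)[OF c R(1) _ in1(1), of t] R \<delta>(2)[OF c] True t by (simp add: Pc add.assoc)
        next
          \<comment> \<open>A negative step is read backwards, from its other end point.\<close>
          case False
          show ?thesis
            using D(2)[OF c R(1) _ in1(2), of "-t"] R \<delta>(2)[OF c] False t
            by (simp add: Pc add.assoc abs_minus_commute)
        qed
        moreover have "\<bar>g (x + P S) - g x - (\<Sum>b\<in>S. p b * (h \<bullet> b))\<bar> \<le> card S * (e' * R)"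
          using insert.IH S by blast
        moreover have "(\<Sum>b\<in>insert c S. p b * (h \<bullet> b)) = p c * t + (\<Sum>b\<in>S. p b * (h \<bullet> b))"
          using insert.hyps by (simp add: t_def)
        moreover have "card (insert c S) * (e' * R) = card S * (e' * R) + e' * R"
          using insert.hyps by (simp add: algebra_simps)
        ultimately show ?case by linarith
      qed (simp add: P_def)
      from this[of Basis] have "\<bar>g (x + h) - g x - (\<Sum>b\<in>Basis. p b * (h \<bullet> b))\<bar> \<le> k * (e' * R)"
        by (simp add: P_def euclidean_representation k_def)
      also have "k * (e' * R) = e * norm h"
        using k by (simp add: e'_def R_def)
      also have "(\<Sum>b\<in>Basis. p b * (h \<bullet> b)) = (\<Sum>b\<in>Basis. p b *\<^sub>R b) \<bullet> h"
        by (simp add: inner_sum_left inner_commute[of h])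
      finally show ?thesis by (simp add: h_def)
    qed
  qed
qed

theorem Rademacher:
  fixes g :: "'a::euclidean_space \<Rightarrow> real"
  assumes g: "C-lipschitz_on UNIV g"
  shows "negligible {x. \<not> (\<exists>v. (g has_derivative (\<lambda>h. v \<bullet> h)) (at x))}"
proof -
  have "\<exists>p. negligible {x. \<not> uniform_slope g b x (p x)}" if "b \<in> Basis" for b
  proof -
    interpret lipschitz_stretch g C b by unfold_locales (use g that in auto)
    obtain \<sigma> where "\<sigma> \<in> borel_measurable borel" "\<And>x. 0 \<le> \<sigma> x" "density lborel (\<lambda>x. ennreal (\<sigma> x)) = N"
      by (rule ex_density) blast
    from negligible_not_uniform_slope[OF this] show ?thesis
      by (rule exI[of _ "\<lambda>x. \<sigma> x - 1 - C"])
  qed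
  then obtain p where p: "\<And>b. b \<in> Basis \<Longrightarrow> negligible {x. \<not> uniform_slope g b x (p b x)}"
    by metis
  have "negligible (\<Union>b\<in>Basis. {x. \<not> uniform_slope g b x (p b x)})"
    by (rule negligible_UN_countable) (auto simp: p countable_finite)
  moreover have "{x. \<not> (\<exists>v. (g has_derivative (\<lambda>h. v \<bullet> h)) (at x))} \<subseteq> (\<Union>b\<in>Basis. {x. \<not> uniform_slope g b x (p b x)})"
  proof (rule subsetI, rule ccontr)
    fix x assume x: "x \<in> {x. \<not> (\<exists>v. (g has_derivative (\<lambda>h. v \<bullet> h)) (at x))}"
      and "x \<notin> (\<Union>b\<in>Basis. {x. \<not> uniform_slope g b x (p b x)})"
    then have "(g has_derivative (\<lambda>h. (\<Sum>b\<in>Basis. p b x *\<^sub>R b) \<bullet> h)) (at x)"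
      by (intro has_derivative_if_uniform_slope) auto
    with x show False by blast
  qed
  ultimately show ?thesis by (rule negligible_subset)
qed

text \<open>Comparison at \<open>y = x\<close> and \<open>t = r\<close>. This translates bounds on
  derivatives into bounds on the densities \<open>\<sigma>\<close>.\<close>

lemma uniform_slope_eq_derivative:
  fixes g :: "'a::euclidean_space \<Rightarrow> real"
  assumes j: "j \<in> Basis" and s: "uniform_slope g j x p"
    and d: "(g has_derivative (\<lambda>h. v \<bullet> h)) (at x)"
  shows "p = v \<bullet> j"
proof -
  have "\<bar>p - v \<bullet> j\<bar> \<le> 0 + e" if e: "0 < e" for e
  proof -
    obtain \<delta> where \<delta>: "0 < \<delta>" "\<And>r y t. 0 < r \<Longrightarrow> r < \<delta> \<Longrightarrow> y \<in> cball x r \<Longrightarrow> t \<in> {0..r} \<Longrightarrow>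
        \<bar>g (y + t *\<^sub>R j) - g y - p * t\<bar> \<le> e/2 * r"
      using s[unfolded uniform_slope_def, rule_format, OF half_gt_zero[OF e]] by blast
    obtain \<delta>' where \<delta>': "0 < \<delta>'" "\<And>y. norm (y - x) < \<delta>' \<Longrightarrow> norm (g y - g x - v \<bullet> (y - x)) \<le> e/2 * norm (y - x)"
      using d[unfolded has_derivative_at_alt, THEN conjunct2, rule_format, OF half_gt_zero[OF e]] by blast
    define r where "r = min \<delta> \<delta>' / 2"
    have r: "0 < r" "r < \<delta>" "r < \<delta>'" using \<delta> \<delta>' by (auto simp: r_def)
    have "\<bar>g (x + r *\<^sub>R j) - g x - p * r\<bar> \<le> e/2 * r" using \<delta>(2)[of r x r] r by simp
    moreover have "\<bar>g (x + r *\<^sub>R j) - g x - (v \<bullet> j) * r\<bar> \<le> e/2 * r"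
      using \<delta>'(2)[of "x + r *\<^sub>R j"] r j by (simp add: mult.commute)
    ultimately have "\<bar>p * r - (v \<bullet> j) * r\<bar> \<le> e * r" by linarith
    then have "\<bar>p - v \<bullet> j\<bar> * r \<le> e * r" using r by (simp add: left_diff_distrib[symmetric] abs_mult)
    then show ?thesis using r by simp
  qed
  then have "\<bar>p - v \<bullet> j\<bar> \<le> 0" by (rule field_le_epsilon)
  then show ?thesis by simp
qed

text \<open>The point of this estimate is that \<open>\<delta>\<close> does not depend on \<open>i\<close>: all the conditions on the \<open>\<partial>\<^sub>j g\<^sub>i\<close>
  define a single set, and only the density of this set at \<open>x\<close> matters.\<close>
lemma uniform_increments:
  fixes g :: "nat \<Rightarrow> 'a::euclidean_space \<Rightarrow> real"
  assumes g: "\<And>i. C-lipschitz_on UNIV (g i)" and j: "j \<in> Basis" and \<alpha>: "0 < \<alpha>" "\<alpha> \<le> 1"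
  shows "negligible {x. (\<forall>i. \<exists>v. (g i has_derivative (\<lambda>h. v \<bullet> h)) (at x) \<and> \<bar>v \<bullet> j\<bar> \<le> \<alpha>) \<and>
    \<not> (\<exists>\<delta>>0. \<forall>r. 0 < r \<and> r < \<delta> \<longrightarrow> (\<forall>i. \<forall>y\<in>cball x r. \<forall>t\<in>{0..r}.
        \<bar>g i (y + t *\<^sub>R j) - g i y\<bar> \<le> (2 + C + 2 * C * DIM('a) + (10 * (1 + 2 * C)) ^ DIM('a)) * (\<alpha> * r)))}"
proof -
  define K where "K = 2 + C + 2 * C * DIM('a) + (10 * (1 + 2 * C)) ^ DIM('a)"
  have L: "lipschitz_stretch (g i) C j" for i by unfold_locales (use g j in auto)
  have "\<exists>\<sigma>. \<sigma> \<in> borel_measurable borel \<and> (\<forall>x. 0 \<le> \<sigma> x) \<and> density lborel (\<lambda>x. ennreal (\<sigma> x)) = lipschitz_stretch.N (g i) C j" for i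
    by (rule lipschitz_stretch.ex_density[OF L]) blast
  then obtain \<sigma> where \<sigma>: "\<And>i. \<sigma> i \<in> borel_measurable borel" "\<And>i x. 0 \<le> \<sigma> i x"
      "\<And>i. density lborel (\<lambda>x. ennreal (\<sigma> i x)) = lipschitz_stretch.N (g i) C j"
    by metis
  have C0: "0 \<le> C" using g[of 0] by (rule lipschitz_on_nonneg)
  \<comment> \<open>Slope zero in direction \<open>j\<close> corresponds to the density
    \<open>1 + C\<close>. Intersecting over all \<open>i\<close> leaves one set, whose density at
    \<open>x\<close> yields one radius for every component.\<close>
  define Z where "Z = (\<Inter>i. {x. \<bar>\<sigma> i x - (1 + C)\<bar> \<le> \<alpha>})"
  have Zb: "Z \<in> sets borel"
    unfolding Z_def
  proof (intro sets.countable_INT' ballI subsetI)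
    fix B assume "B \<in> range (\<lambda>i. {x. \<bar>\<sigma> i x - (1 + C)\<bar> \<le> \<alpha>})"
    then obtain i where B: "B = {x. \<bar>\<sigma> i x - (1 + C)\<bar> \<le> \<alpha>}" by blast
    have "(\<lambda>x. \<bar>\<sigma> i x - (1 + C)\<bar>) \<in> borel_measurable borel" using \<sigma>(1)[of i] by simp
    from measurable_sets[OF this, of "{..\<alpha>}"] show "B \<in> sets borel" by (simp add: B vimage_def)
  qed auto
  define W where "W = {x \<in> Z. \<not> full_density Z x} \<union> (\<Union>i. {x. \<not> uniform_slope (g i) j x (\<sigma> i x - 1 - C)})"
  have "negligible W"
    unfolding W_def using Zb
    by (intro negligible_Un negligible_UN_countable Lebesgue_density)
       (auto intro!: lipschitz_stretch.negligible_not_uniform_slope[OF L] \<sigma>)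
  moreover have "{x. (\<forall>i. \<exists>v. (g i has_derivative (\<lambda>h. v \<bullet> h)) (at x) \<and> \<bar>v \<bullet> j\<bar> \<le> \<alpha>) \<and>
    \<not> (\<exists>\<delta>>0. \<forall>r. 0 < r \<and> r < \<delta> \<longrightarrow> (\<forall>i. \<forall>y\<in>cball x r. \<forall>t\<in>{0..r}.
        \<bar>g i (y + t *\<^sub>R j) - g i y\<bar> \<le> K * (\<alpha> * r)))} \<subseteq> W"
  proof (rule subsetI, rule ccontr)
    fix x assume x: "x \<in> {x. (\<forall>i. \<exists>v. (g i has_derivative (\<lambda>h. v \<bullet> h)) (at x) \<and> \<bar>v \<bullet> j\<bar> \<le> \<alpha>) \<and>
      \<not> (\<exists>\<delta>>0. \<forall>r. 0 < r \<and> r < \<delta> \<longrightarrow> (\<forall>i. \<forall>y\<in>cball x r. \<forall>t\<in>{0..r}.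
        \<bar>g i (y + t *\<^sub>R j) - g i y\<bar> \<le> K * (\<alpha> * r)))}" and xW: "x \<notin> W"
    have "x \<in> Z"
      unfolding Z_def
    proof safe
      fix i
      obtain v where v: "(g i has_derivative (\<lambda>h. v \<bullet> h)) (at x)" "\<bar>v \<bullet> j\<bar> \<le> \<alpha>" using x by blast
      have "uniform_slope (g i) j x (\<sigma> i x - 1 - C)" using xW by (simp add: W_def)
      from uniform_slope_eq_derivative[OF j this v(1)] v(2) show "\<bar>\<sigma> i x - (1 + C)\<bar> \<le> \<alpha>"
        by (simp add: algebra_simps)
    qed
    then have fd: "full_density Z x" using xW by (simp add: W_def)
    define c where "c = DIM('a) + (2::real)"
    obtain \<delta> where \<delta>: "0 < \<delta>" "\<And>r::real. 0 < r \<Longrightarrow> r < \<delta> \<Longrightarrow>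
        emeasure lborel (cball x (c * r) - Z) \<le> ennreal (\<alpha> * (2 * \<alpha>) ^ (DIM('a) - 1) * r ^ DIM('a))"
      using full_density_scaled[OF Zb fd, of c "\<alpha> * (2 * \<alpha>) ^ (DIM('a) - 1)"] \<alpha>
      by (auto simp: c_def add_pos_nonneg)
    have "\<bar>g i (y + t *\<^sub>R j) - g i y\<bar> \<le> K * (\<alpha> * r)"
      if r: "0 < r" "r < \<delta>" and y: "y \<in> cball x r" and t: "t \<in> {0..r}" for i r y t
    proof -
      have eq: "\<alpha> * (2 * \<alpha>) ^ (DIM('a) - 1) * r ^ DIM('a) = \<alpha> * (2 * (\<alpha> * r)) ^ (DIM('a) - 1) * r"
        using power_minus_mult[of "DIM('a)" r] by (simp add: power_mult_distrib mult_ac)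
      \<comment> \<open>With \<open>p = 1 + C\<close> the subtracted slope vanishes and the plain
        increment is bounded; the constant becomes \<open>K\<close>.\<close>
      have "\<bar>g i (y + t *\<^sub>R j) - g i y - (1 + C - 1 - C) * t\<bar> \<le>
          (1 + 2 * C * DIM('a) + lipschitz_stretch.M TYPE('a) C + (1 + C)) * (\<alpha> * r)"
      proof (rule lipschitz_stretch.increment_estimate[OF L \<sigma>(1) \<sigma>(2) \<sigma>(3) Zb])
        show "\<bar>\<sigma> i z - (1 + C)\<bar> \<le> \<alpha>" if "z \<in> Z" for z using that by (auto simp: Z_def)
        show "emeasure lborel (cball x (real (DIM('a) + 2) * r) - Z) \<le> ennreal (\<alpha> * (2 * (\<alpha> * r)) ^ (DIM('a) - 1) * r)"
          using \<delta>(2)[OF r] unfolding eq c_def by (simp add: add.commute)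
      qed (use r y t \<alpha> C0 in auto)
      then show ?thesis by (simp add: K_def lipschitz_stretch.M_def[OF L] algebra_simps)
    qed
    with x \<delta>(1) show False by blast
  qed
  ultimately show ?thesis unfolding K_def by (rule negligible_subset)
qed

text \<open>The formula gives the largest extension with the same constant. Extending the components
  makes differentiability on the whole space available.\<close>

lemma McShane_extension:
  fixes f :: "'a::metric_space \<Rightarrow> real"
  assumes f: "C-lipschitz_on E f"
  obtains g where "C-lipschitz_on UNIV g" "\<And>x. x \<in> E \<Longrightarrow> g x = f x"
proof (cases "E = {}")
  case True
  then show thesis using that[of "\<lambda>_. 0"] lipschitz_on_nonneg[OF f] by (auto simp: lipschitz_on_def)
next
  case False
  have C: "0 \<le> C" using f by (rule lipschitz_on_nonneg)
  define g where "g x = (INF z\<in>E. f z + C * dist x z)" for x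
  have le: "f y - C * dist x y \<le> f z + C * dist x z" if "y \<in> E" "z \<in> E" for x y z
  proof -
    have "f y - f z \<le> C * dist y z" using lipschitz_onD[OF f that] by (simp add: dist_real_def)
    also have "\<dots> \<le> C * (dist x y + dist x z)" using C by (intro mult_left_mono dist_triangle3) auto
    finally show ?thesis by (simp add: algebra_simps)
  qed
  have bdd: "bdd_below ((\<lambda>z. f z + C * dist x z) ` E)" for x
  proof -
    obtain y where "y \<in> E" using False by blast
    then show ?thesis using le[of y _ x] by (intro bdd_belowI2[of _ "f y - C * dist x y"]) auto
  qed
  have g_le: "g x \<le> g y + C * dist x y" for x y
  proof -
    have "g x - C * dist x y \<le> g y"
      unfolding g_def[of y]
    proof (rule cINF_greatest[OF False])
      fix z assume z: "z \<in> E"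
      have "g x \<le> f z + C * dist x z" unfolding g_def by (rule cINF_lower[OF bdd z])
      also have "C * dist x z \<le> C * (dist x y + dist y z)" using C by (intro mult_left_mono dist_triangle) auto
      finally show "g x - C * dist x y \<le> f z + C * dist y z" by (simp add: algebra_simps)
    qed
    then show ?thesis by simp
  qed
  show thesis
  proof
    show "C-lipschitz_on UNIV g"
    proof (rule lipschitz_onI)
      fix x y show "dist (g x) (g y) \<le> C * dist x y"
        using g_le[of x y] g_le[of y x] by (simp add: dist_real_def abs_le_iff dist_commute)
    qed (rule C)
    fix x assume x: "x \<in> E"
    show "g x = f x"
    proof (rule antisym)
      show "g x \<le> f x" using cINF_lower[OF bdd x, of x] by (simp add: g_def)
      show "f x \<le> g x" unfolding g_def using le[OF x, of _ x] by (intro cINF_greatest False) auto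
    qed
  qed
qed

section \<open>Approximate differentials and the rank\<close>

lemma density_point_iff_Diff:
  fixes S :: "'a::euclidean_space set"
  assumes S: "S \<in> sets lebesgue"
  shows "density_point S x \<longleftrightarrow>
    ((\<lambda>r. measure lebesgue (ball x r - S) / measure lebesgue (ball x r)) \<longlongrightarrow> 0) (at_right 0)"
proof -
  have eq: "eventually (\<lambda>r. measure lebesgue (ball x r - S) / measure lebesgue (ball x r)
      = 1 - measure lebesgue (S \<inter> ball x r) / measure lebesgue (ball x r)) (at_right 0)"
    using eventually_at_right_less
  proof eventually_elim
    case (elim r)
    have "S \<inter> ball x r \<in> sets lebesgue" using S by (intro sets.Int) auto
    then have "measure lebesgue (ball x r - S) = measure lebesgue (ball x r) - measure lebesgue (S \<inter> ball x r)"
      using measure_Diff[of lebesgue "ball x r" "S \<inter> ball x r"] S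
      by (simp add: Diff_Int fmeasurableD2[OF lmeasurable_ball] del: emeasure_completion)
    moreover have "measure lebesgue (ball x r) > 0" using elim by (simp add: content_ball_pos)
    ultimately show ?case by (simp add: field_simps)
  qed
  show ?thesis
    unfolding density_point_def tendsto_cong[OF eq]
  proof
    assume "((\<lambda>r. measure lebesgue (S \<inter> ball x r) / measure lebesgue (ball x r)) \<longlongrightarrow> 1) (at_right 0)"
    from tendsto_diff[OF tendsto_const[of 1] this]
    show "((\<lambda>r. 1 - measure lebesgue (S \<inter> ball x r) / measure lebesgue (ball x r)) \<longlongrightarrow> 0) (at_right 0)" by simp
  next
    assume "((\<lambda>r. 1 - measure lebesgue (S \<inter> ball x r) / measure lebesgue (ball x r)) \<longlongrightarrow> 0) (at_right 0)"
    from tendsto_diff[OF tendsto_const[of 1] this]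
    show "((\<lambda>r. measure lebesgue (S \<inter> ball x r) / measure lebesgue (ball x r)) \<longlongrightarrow> 1) (at_right 0)" by simp
  qed
qed

lemma density_point_if_full_density:
  fixes S :: "'a::euclidean_space set"
  assumes S: "S \<in> sets lebesgue" and fd: "full_density S x"
  shows "density_point S x"
  unfolding density_point_iff_Diff[OF S]
proof (rule tendstoI)
  fix e :: real assume e: "0 < e"
  let ?v = "unit_ball_vol DIM('a)"
  have v: "0 < ?v" by simp
  obtain \<delta> where \<delta>: "0 < \<delta>" "\<And>r. 0 < r \<Longrightarrow> r < \<delta> \<Longrightarrow> emeasure lebesgue (cball x r - S) \<le> ennreal (e/2 * ?v * r ^ DIM('a))"
    using fd[unfolded full_density_def, rule_format, of "e/2 * ?v"] e v by auto
  have "eventually (\<lambda>r. r < \<delta>) (at_right 0)" using \<delta>(1) by (auto intro: eventually_at_rightI[of 0 \<delta>])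
  then show "\<forall>\<^sub>F r in at_right 0. dist (measure lebesgue (ball x r - S) / measure lebesgue (ball x r)) 0 < e"
    using eventually_at_right_less
  proof eventually_elim
    case (elim r)
    have "emeasure lebesgue (ball x r - S) \<le> emeasure lebesgue (cball x r - S)"
      using S by (intro emeasure_mono) auto
    also have "\<dots> \<le> ennreal (e/2 * ?v * r ^ DIM('a))" using \<delta>(2) elim by blast
    finally have "measure lebesgue (ball x r - S) \<le> e/2 * ?v * r ^ DIM('a)"
      unfolding measure_def using e v elim by (intro enn2real_leI) auto
    also have "\<dots> < e * measure lebesgue (ball x r)"
      using e v elim by (simp add: content_ball)
    finally have "measure lebesgue (ball x r - S) < e * measure lebesgue (ball x r)" .
    moreover have "measure lebesgue (ball x r) > 0" using elim(2) by (simp add: content_ball_pos)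
    ultimately show ?case by (simp add: field_simps)
  qed
qed

text \<open>If \<open>u \<noteq> 0\<close>, then \<open>S\<close> misses the balls \<open>ball (x + (r/2) u/|u|) (r/4)\<close> for small \<open>r\<close>.\<close>
lemma density_point_linear_limit_0:
  fixes S :: "'a::euclidean_space set"
  assumes S: "S \<in> sets lebesgue" and dp: "density_point S x"
    and lim: "((\<lambda>y. u \<bullet> (y - x) / norm (y - x)) \<longlongrightarrow> 0) (at x within S)"
  shows "u = 0"
proof (rule ccontr)
  assume u: "u \<noteq> 0"
  define e where "e = u /\<^sub>R norm u"
  have e: "norm e = 1" "u \<bullet> e = norm u"
    using u by (auto simp: e_def power2_norm_eq_inner[symmetric] power2_eq_square)
  \<comment> \<open>On the ball of radius \<open>r/4\<close> considered below,
    \<open>u \<bullet> (y - x)\<close> is at least \<open>norm u * (r/4)\<close> and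
    \<open>norm (y - x)\<close> is below \<open>3/4 * r\<close>, so the quotient exceeds
    \<open>norm u / 3\<close>.\<close>
  have "0 < norm u / 3" using u by simp
  from tendstoD[OF lim this] obtain \<delta> where \<delta>: "0 < \<delta>"
      "\<And>y. y \<in> S \<Longrightarrow> y \<noteq> x \<Longrightarrow> dist y x < \<delta> \<Longrightarrow> \<bar>u \<bullet> (y - x) / norm (y - x)\<bar> < norm u / 3"
    unfolding eventually_at by auto
  have disj: "ball (x + (r/2) *\<^sub>R e) (r/4) \<subseteq> ball x r - S" if r: "0 < r" "r < \<delta>" for r
  proof
    fix y assume "y \<in> ball (x + (r/2) *\<^sub>R e) (r/4)"
    define w where "w = y - x - (r/2) *\<^sub>R e"
    have w: "norm w < r/4" using \<open>y \<in> _\<close> by (simp add: w_def dist_norm norm_minus_commute algebra_simps)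
    have y: "y - x = (r/2) *\<^sub>R e + w" by (simp add: w_def)
    have n: "norm (y - x) < 3 / 4 * r"
      unfolding y using norm_triangle_ineq[of "(r/2) *\<^sub>R e" w] w e r by simp
    have "\<bar>u \<bullet> w\<bar> \<le> norm u * (r/4)"
      using Cauchy_Schwarz_ineq2[of u w] mult_left_mono[OF less_imp_le[OF w] norm_ge_zero[of u]] by linarith
    then have uy: "norm u * (r/4) \<le> u \<bullet> (y - x)"
    proof -
      have "u \<bullet> (y - x) = r/2 * norm u + u \<bullet> w" unfolding y using e by (simp add: inner_add_right)
      then show ?thesis using \<open>\<bar>u \<bullet> w\<bar> \<le> _\<close> by (simp add: abs_le_iff mult.commute)
    qed
    have "y \<notin> S"
    proof
      assume "y \<in> S"
      have "y \<noteq> x" using uy u r by (auto simp: mult_le_0_iff)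
      then have "u \<bullet> (y - x) < norm u / 3 * norm (y - x)"
        using \<delta>(2)[OF \<open>y \<in> S\<close>] n r by (auto simp: dist_norm field_simps abs_less_iff)
      also have "\<dots> \<le> norm u / 3 * (3 / 4 * r)" using n by (intro mult_left_mono) auto
      finally show False using uy by simp
    qed
    then show "y \<in> ball x r - S" using n r by (simp add: dist_norm norm_minus_commute)
  qed
  have "eventually (\<lambda>r. r < \<delta>) (at_right 0)" using \<delta>(1) by (auto intro: eventually_at_rightI[of 0 \<delta>])
  \<comment> \<open>The ball missed by \<open>S\<close> has radius \<open>r/4\<close>, hence
    occupies the fraction \<open>(1/4) ^ DIM('a)\<close> of \<open>ball x r\<close>.\<close>
  moreover have "\<forall>\<^sub>F r in at_right 0. dist (measure lebesgue (ball x r - S) / measure lebesgue (ball x r)) 0 < (1/4) ^ DIM('a)"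
    using dp unfolding density_point_iff_Diff[OF S] by (rule tendstoD) simp
  moreover have "\<forall>\<^sub>F r::real in at_right 0. 0 < r" by (rule eventually_at_right_less)
  ultimately have "\<forall>\<^sub>F r::real in at_right 0. False"
  proof eventually_elim
    case (elim r)
    have "measure lebesgue (ball (x + (r/2) *\<^sub>R e) (r/4)) \<le> measure lebesgue (ball x r - S)"
      by (rule measure_mono_fmeasurable) (use disj[of r] elim S in \<open>auto intro: fmeasurable_Diff\<close>)
    moreover have "measure lebesgue (ball (x + (r/2) *\<^sub>R e) (r/4)) = (1/4) ^ DIM('a) * measure lebesgue (ball x r)"
      using elim by (simp add: content_ball power_divide)
    moreover have "measure lebesgue (ball x r) > 0" using elim(3) by (simp add: content_ball_pos)
    ultimately show False using elim(2) by (simp add: field_simps)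
  qed
  then show False by simp
qed

text \<open>For existence, \<open>E\<close> itself serves as the approximating set. For uniqueness,
  the difference of two candidates is a linear form that is \<open>o(norm (y - x))\<close> along a
  set with density point \<open>x\<close>, hence zero.\<close>

lemma apD_eq_derivative:
  fixes g h :: "'a::euclidean_space \<Rightarrow> real"
  assumes E: "E \<in> sets lebesgue" "x \<in> E" "density_point E x"
    and g: "(g has_derivative (\<lambda>w. v \<bullet> w)) (at x)" and eq: "\<And>y. y \<in> E \<Longrightarrow> h y = g y"
  shows "apD h E x = v"
  unfolding apD_def
proof (rule the_equality)
  have lim: "((\<lambda>y. (h y - h x - v \<bullet> (y - x)) / norm (y - x)) \<longlongrightarrow> 0) (at x within S)" if "S \<subseteq> E" for S
  proof -
    have "(g has_derivative (\<lambda>w. v \<bullet> w)) (at x within S)" using g by (rule has_derivative_at_withinI)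
    then have "((\<lambda>y. (g y - g x - v \<bullet> (y - x)) / norm (y - x)) \<longlongrightarrow> 0) (at x within S)"
      unfolding has_derivative_within by (simp add: divide_inverse_commute diff_diff_eq)
    then show ?thesis
    proof (rule Lim_transform_eventually)
      show "\<forall>\<^sub>F y in at x within S. (g y - g x - v \<bullet> (y - x)) / norm (y - x) = (h y - h x - v \<bullet> (y - x)) / norm (y - x)"
        unfolding eventually_at_filter using that eq E(2) by (intro always_eventually) (auto simp: subset_iff)
    qed
  qed
  then show "has_ap_derivative h (\<lambda>w. v \<bullet> w) E x"
    unfolding has_ap_derivative_def using E bounded_linear_inner_right[THEN bounded_linear.linear] by blast
  fix v' assume "has_ap_derivative h (\<lambda>w. v' \<bullet> w) E x"
  then obtain S where S: "S \<in> sets lebesgue" "S \<subseteq> E" "density_point S x"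
      "((\<lambda>y. (h y - h x - v' \<bullet> (y - x)) / norm (y - x)) \<longlongrightarrow> 0) (at x within S)"
    unfolding has_ap_derivative_def by blast
  have "((\<lambda>y. (v - v') \<bullet> (y - x) / norm (y - x)) \<longlongrightarrow> 0) (at x within S)"
    using tendsto_diff[OF S(4) lim[OF S(2)]]
    by (simp add: diff_divide_distrib[symmetric] inner_diff_left algebra_simps)
  from density_point_linear_limit_0[OF S(1,3) this] show "v' = v" by simp
qed

lemma rank_seq_less_iff:
  fixes w :: "nat \<Rightarrow> 'a::euclidean_space"
  shows "rank_seq w < DIM('a) \<longleftrightarrow> (\<exists>u. norm u = 1 \<and> (\<forall>i. w i \<bullet> u = 0))"
proof
  assume "rank_seq w < DIM('a)"
  then have "dim (range w) < DIM('a)" by (simp add: rank_seq_def)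
  then obtain u where u: "u \<noteq> 0" "\<And>y. y \<in> span (range w) \<Longrightarrow> orthogonal u y"
    by (rule orthogonal_to_subspace_exists) blast
  have "w i \<bullet> (u /\<^sub>R norm u) = 0" for i
    using u(2)[of "w i"] by (simp add: span_base orthogonal_def inner_commute)
  moreover have "norm (u /\<^sub>R norm u) = 1" using u(1) by simp
  ultimately show "\<exists>u. norm u = 1 \<and> (\<forall>i. w i \<bullet> u = 0)" by blast
next
  assume "\<exists>u. norm u = 1 \<and> (\<forall>i. w i \<bullet> u = 0)"
  then obtain u where u: "norm u = 1" "\<And>i. w i \<bullet> u = 0" by blast
  have "dim (range w) \<noteq> DIM('a)"
  proof
    assume "dim (range w) = DIM('a)"
    then have "u \<in> span (range w)" by (simp add: dim_eq_full)
    then have "orthogonal u u"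
      by (rule orthogonal_to_span) (use u in \<open>auto simp: orthogonal_def inner_commute\<close>)
    then show False using u(1) by (auto simp: orthogonal_self)
  qed
  then show "rank_seq w < DIM('a)"
    using dim_subset_UNIV[of "range w"] by (simp add: rank_seq_def)
qed

text \<open>A failure of the lower bound along \<open>y\<^sub>n \<rightarrow> x\<close> produces, by compactness of the sphere, a direction in
  which all the components have zero derivative.\<close>
lemma lower_Lipschitz_at_full_rank:
  fixes f :: "'a::euclidean_space \<Rightarrow> 'm::metric_space" and g :: "nat \<Rightarrow> 'a \<Rightarrow> real"
  assumes fg: "\<And>i y z. y \<in> E \<Longrightarrow> z \<in> E \<Longrightarrow> \<bar>g i y - g i z\<bar> \<le> dist (f y) (f z)" and x: "x \<in> E"
    and d: "\<And>i. (g i has_derivative (\<lambda>h. v i \<bullet> h)) (at x)"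
    and full: "\<not> (\<exists>u. norm u = 1 \<and> (\<forall>i. v i \<bullet> u = 0))"
  shows "\<exists>n. \<forall>y\<in>E. norm (y - x) < 1 / Suc n \<longrightarrow> norm (y - x) \<le> Suc n * dist (f y) (f x)"
proof (rule ccontr)
  assume "\<not> ?thesis"
  then have "\<forall>n. \<exists>y\<in>E. norm (y - x) < 1 / Suc n \<and> Suc n * dist (f y) (f x) < norm (y - x)"
    by (metis not_less)
  then obtain y where y: "\<And>n. y n \<in> E" "\<And>n. norm (y n - x) < 1 / Suc n"
      "\<And>n. Suc n * dist (f (y n)) (f x) < norm (y n - x)" by metis
  have pos: "0 < norm (y n - x)" for n
    using y(3)[of n] by (meson le_less_trans mult_nonneg_nonneg of_nat_0_le_iff zero_le_dist)
  define w where "w n = (y n - x) /\<^sub>R norm (y n - x)" for n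
  have "w n \<in> sphere 0 1" for n using pos[of n] by (simp add: w_def)
  then obtain u \<phi> where u: "u \<in> sphere 0 1" and \<phi>: "strict_mono \<phi>" "(w \<circ> \<phi>) \<longlonglongrightarrow> u"
    using compact_sphere[of "0::'a" 1] unfolding compact_def by metis
  have "v i \<bullet> u = 0" for i
  proof -
    have "(\<lambda>n. v i \<bullet> w n) \<longlonglongrightarrow> 0"
    proof (rule LIMSEQ_I)
      fix e :: real assume e: "0 < e"
      obtain \<delta> where \<delta>: "0 < \<delta>" "\<And>z. norm (z - x) < \<delta> \<Longrightarrow> norm (g i z - g i x - v i \<bullet> (z - x)) \<le> e/2 * norm (z - x)"
        using d[unfolded has_derivative_at_alt, THEN conjunct2, rule_format, OF half_gt_zero[OF e]] by blast
      obtain n0 where n0: "1 / Suc n0 < min \<delta> (e/2)" using nat_approx_posE[of "min \<delta> (e/2)"] \<delta> e by auto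
      have "norm (v i \<bullet> w n - 0) < e" if n: "n0 \<le> n" for n
      proof -
        have "1 / Suc n \<le> 1 / Suc n0" using n by (simp add: field_simps)
        then have sm: "1 / Suc n < \<delta>" "1 / Suc n < e/2" using n0 by auto
        have a: "\<bar>g i (y n) - g i x - v i \<bullet> (y n - x)\<bar> \<le> e/2 * norm (y n - x)"
          using \<delta>(2)[of "y n"] y(2)[of n] sm(1) by simp
        have "\<bar>g i (y n) - g i x\<bar> \<le> dist (f (y n)) (f x)" using fg y(1) x by blast
        also have "\<dots> < norm (y n - x) * (1 / Suc n)" using y(3)[of n] by (simp add: field_simps)
        also have "\<dots> \<le> norm (y n - x) * (e/2)" using sm(2) by (intro mult_left_mono) auto
        finally have "\<bar>v i \<bullet> (y n - x)\<bar> < e * norm (y n - x)"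
          using a mult.commute[of "norm (y n - x)" "e/2"] by linarith
        then show ?thesis
            using pos[of n] unfolding w_def inner_scaleR_right by (simp add: abs_mult field_simps del: scaleR_diff_right)
      qed
      then show "\<exists>no. \<forall>n\<ge>no. norm (v i \<bullet> w n - 0) < e" by blast
    qed
    then have "(\<lambda>n. v i \<bullet> (w \<circ> \<phi>) n) \<longlonglongrightarrow> 0"
      using LIMSEQ_subseq_LIMSEQ[OF _ \<phi>(1)] by (auto simp: o_def)
    moreover have "(\<lambda>n. v i \<bullet> (w \<circ> \<phi>) n) \<longlonglongrightarrow> v i \<bullet> u"
      by (intro tendsto_inner tendsto_const \<phi>(2))
    ultimately show ?thesis using LIMSEQ_unique by blast
  qed
  with u full show False by auto
qed

text \<open>On a sufficiently small piece of \<open>Q n\<close> the local lower bound holds between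
  any two points, so \<open>f\<close> has a Lipschitz inverse there, and this inverse carries the
  null image back to a null set.\<close>

lemma negligible_lower_Lipschitz:
  fixes f :: "'a::euclidean_space \<Rightarrow> 'm::metric_space"
  assumes null: "hausdorff_content DIM('a) (f ` E) = 0"
  shows "negligible {x \<in> E. \<exists>n. \<forall>y\<in>E. norm (y - x) < 1 / Suc n \<longrightarrow> norm (y - x) \<le> Suc n * dist (f y) (f x)}"
proof -
  define Q where "Q n = {x \<in> E. \<forall>y\<in>E. norm (y - x) < 1 / Suc n \<longrightarrow> norm (y - x) \<le> Suc n * dist (f y) (f x)}" for n
  obtain D :: "'a set" where D: "countable D" "D \<subseteq> UNIV" "UNIV \<subseteq> closure D"
    using separable[of "UNIV :: 'a set"] by blast
  have "hausdorff_content DIM('a) (Q n \<inter> ball c (1 / (2 * Suc n))) = 0" for n c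
  proof -
    \<comment> \<open>The radius is half of \<open>1 / Suc n\<close>, so any two points of the piece
      are close enough for the bound in \<open>Q n\<close>.\<close>
    define A where "A = Q n \<inter> ball c (1 / (2 * Suc n))"
    have low: "dist y x \<le> Suc n * dist (f y) (f x)" if "x \<in> A" "y \<in> A" for x y
    proof -
      have "norm (y - x) < 1 / (2 * Suc n) + 1 / (2 * Suc n)"
        using that norm_triangle_lt[of "c - x" "y - c"] unfolding A_def
        by (auto simp: dist_norm norm_minus_commute intro: dist_triangle_less_add[of _ c, unfolded dist_norm])
      also have "\<dots> = 1 / Suc n" by (simp add: field_simps)
      finally show ?thesis using that by (auto simp: A_def Q_def dist_norm)
    qed
    then have inj: "inj_on f A" by (intro inj_onI) (metis dist_self dist_le_zero_iff mult_zero_right)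
    have "(real (Suc n))-lipschitz_on (f ` A) (inv_into A f)"
      using low by (intro lipschitz_onI) (auto simp: inv_into_f_f[OF inj])
    then have "hausdorff_content DIM('a) (inv_into A f ` (f ` A)) \<le> ennreal (real (Suc n) ^ DIM('a)) * hausdorff_content DIM('a) (f ` A)"
      by (rule hausdorff_content_lipschitz_image) auto
    moreover have "hausdorff_content DIM('a) (f ` A) \<le> hausdorff_content DIM('a) (f ` E)"
      by (rule hausdorff_content_mono) (auto simp: A_def Q_def)
    ultimately have "hausdorff_content DIM('a) (inv_into A f ` (f ` A)) \<le> 0" using null by simp
    moreover have "inv_into A f ` (f ` A) = A" using inj by (simp add: inv_into_image_cancel)
    ultimately show ?thesis by (simp add: A_def)
  qed
  then have "negligible (\<Union>n. \<Union>c\<in>D. Q n \<inter> ball c (1 / (2 * Suc n)))"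
    by (intro negligible_UN_countable negligible_if_hausdorff_content_0) (auto simp: D(1))
  moreover have "{x \<in> E. \<exists>n. \<forall>y\<in>E. norm (y - x) < 1 / Suc n \<longrightarrow> norm (y - x) \<le> Suc n * dist (f y) (f x)}
      \<subseteq> (\<Union>n. \<Union>c\<in>D. Q n \<inter> ball c (1 / (2 * Suc n)))"
  proof
    fix x assume "x \<in> {x \<in> E. \<exists>n. \<forall>y\<in>E. norm (y - x) < 1 / Suc n \<longrightarrow> norm (y - x) \<le> Suc n * dist (f y) (f x)}"
    then obtain n where "x \<in> Q n" by (auto simp: Q_def)
    moreover have "x \<in> closure D" using D(3) by blast
    then obtain c where "c \<in> D" "dist c x < 1 / (2 * Suc n)"
      unfolding closure_approachable by (meson divide_pos_pos of_nat_0_less_iff zero_less_Suc zero_less_one mult_pos_pos zero_less_numeral)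
    ultimately show "x \<in> (\<Union>n. \<Union>c\<in>D. Q n \<inter> ball c (1 / (2 * Suc n)))" by auto
  qed
  ultimately show ?thesis by (rule negligible_subset)
qed

section \<open>Null images, rotated directions and gradient bounds\<close>

lemma hausdorff_content_null_cover:
  assumes "A \<subseteq> B1 \<union> B2" "hausdorff_content k B1 = 0" "hausdorff_content k B2 = 0" "0 < k"
  shows "hausdorff_content k A = 0"
proof -
  have "hausdorff_content k (\<Union>S\<in>{B1, B2}. S) = 0"
    by (rule hausdorff_content_UN_countable_null) (use assms in auto)
  then have "hausdorff_content k (B1 \<union> B2) = 0" by simp
  then show ?thesis using hausdorff_content_mono[OF assms(1), of k] by simp
qed

lemma hausdorff_content_lipschitz_image_negligible:
  fixes f :: "'a::euclidean_space \<Rightarrow> 'm::metric_space"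
  assumes f: "C-lipschitz_on A f" and A: "negligible A"
  shows "hausdorff_content DIM('a) (f ` A) = 0"
proof -
  have "A \<in> null_sets lebesgue" using A by (simp add: negligible_iff_null_sets)
  then have "hausdorff_content DIM('a) A \<le> 0"
    using hausdorff_content_le_lebesgue[of A] by (simp add: null_setsD1 null_setsD2)
  then have A0: "hausdorff_content DIM('a) A = 0" by simp
  \<comment> \<open>\<open>C\<close> may be zero, while the content estimate asks for a positive
    constant.\<close>
  have "(C + 1)-lipschitz_on A f" using f by (rule lipschitz_on_mono) auto
  then have "hausdorff_content DIM('a) (f ` A) \<le> ennreal ((C + 1) ^ DIM('a)) * hausdorff_content DIM('a) A"
    using lipschitz_on_nonneg[OF f] by (intro hausdorff_content_lipschitz_image) auto
  then show ?thesis using A0 by simp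
qed

text \<open>The slope of \<open>g i\<close> at \<open>x\<close> in direction \<open>T j\<close> is
  that of \<open>g i \<circ> T\<close> at the preimage \<open>S x\<close> in direction
  \<open>j\<close>. Since \<open>T\<close> is an isometry, it preserves the constant
  \<open>C\<close>, balls and null sets.\<close>

lemma uniform_increments_rotated:
  fixes g :: "nat \<Rightarrow> 'a::euclidean_space \<Rightarrow> real" and T :: "'a \<Rightarrow> 'a"
  assumes g: "\<And>i. C-lipschitz_on UNIV (g i)" and j: "j \<in> Basis" and T: "orthogonal_transformation T"
    and \<alpha>: "0 < \<alpha>" "\<alpha> \<le> 1"
  shows "negligible {x. (\<forall>i. \<exists>v. (g i has_derivative (\<lambda>h. v \<bullet> h)) (at x) \<and> \<bar>v \<bullet> T j\<bar> \<le> \<alpha>) \<and>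
    \<not> (\<exists>\<delta>>0. \<forall>r. 0 < r \<and> r < \<delta> \<longrightarrow> (\<forall>i. \<forall>y\<in>cball x r. \<forall>t\<in>{0..r}.
        \<bar>g i (y + t *\<^sub>R T j) - g i y\<bar> \<le> (2 + C + 2 * C * DIM('a) + (10 * (1 + 2 * C)) ^ DIM('a)) * (\<alpha> * r)))}"
    (is "negligible ?X")
proof -
  define K where "K = 2 + C + 2 * C * DIM('a) + (10 * (1 + 2 * C)) ^ DIM('a)"
  define S where "S = inv T"
  have TS: "T (S x) = x" for x
    unfolding S_def by (rule surj_f_inv_f[OF orthogonal_transformation_surj[OF T]])
  have lin: "linear T" and Tn: "norm (T x) = norm x" and Ti: "T x \<bullet> T y = x \<bullet> y" for x y
    using T by (auto simp: orthogonal_transformation_linear orthogonal_transformation_norm orthogonal_transformation_def)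
  have Tdist: "dist (T x) (T y) = dist x y" for x y
    using Tn[of "x - y"] by (simp add: dist_norm linear_diff[OF lin])
  have TL: "1-lipschitz_on A T" for A by (rule lipschitz_onI) (auto simp: Tdist)
  have gT: "C-lipschitz_on UNIV (g i \<circ> T)" for i
    using lipschitz_on_compose[OF TL lipschitz_on_subset[OF g], of UNIV i] by simp
  define X where "X = {x. (\<forall>i. \<exists>v. ((g i \<circ> T) has_derivative (\<lambda>h. v \<bullet> h)) (at x) \<and> \<bar>v \<bullet> j\<bar> \<le> \<alpha>) \<and>
    \<not> (\<exists>\<delta>>0. \<forall>r. 0 < r \<and> r < \<delta> \<longrightarrow> (\<forall>i. \<forall>y\<in>cball x r. \<forall>t\<in>{0..r}.
        \<bar>(g i \<circ> T) (y + t *\<^sub>R j) - (g i \<circ> T) y\<bar> \<le> K * (\<alpha> * r)))}"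
  have "negligible X" unfolding X_def K_def by (rule uniform_increments[OF gT j \<alpha>])
  then have "negligible (T ` X)"
    by (rule negligible_if_hausdorff_content_0[OF hausdorff_content_lipschitz_image_negligible[OF TL]])
  moreover have "?X \<subseteq> T ` X"
  proof
    fix x assume x: "x \<in> ?X"
    have "S x \<in> X"
      unfolding X_def mem_Collect_eq
    proof (intro conjI allI notI)
      fix i
      obtain v where v: "(g i has_derivative (\<lambda>h. v \<bullet> h)) (at x)" "\<bar>v \<bullet> T j\<bar> \<le> \<alpha>" using x by blast
      have "(T has_derivative T) (at (S x))" using lin by (rule linear_imp_has_derivative)
      moreover have "(g i has_derivative (\<lambda>h. v \<bullet> h)) (at (T (S x)))" using v(1) by (simp add: TS)
      ultimately have "((g i \<circ> T) has_derivative ((\<lambda>h. v \<bullet> h) \<circ> T)) (at (S x))"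
        by (rule diff_chain_at)
      moreover have "(\<lambda>h. v \<bullet> h) \<circ> T = (\<lambda>h. S v \<bullet> h)"
        using Ti[of "S v"] by (auto simp: TS)
      moreover have "\<bar>S v \<bullet> j\<bar> \<le> \<alpha>" using v(2) Ti[of "S v" j] by (simp add: TS)
      ultimately show "\<exists>v. ((g i \<circ> T) has_derivative (\<lambda>h. v \<bullet> h)) (at (S x)) \<and> \<bar>v \<bullet> j\<bar> \<le> \<alpha>" by auto
    next
      assume "\<exists>\<delta>>0. \<forall>r. 0 < r \<and> r < \<delta> \<longrightarrow> (\<forall>i. \<forall>y\<in>cball (S x) r. \<forall>t\<in>{0..r}.
        \<bar>(g i \<circ> T) (y + t *\<^sub>R j) - (g i \<circ> T) y\<bar> \<le> K * (\<alpha> * r))"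
      then obtain \<delta> where \<delta>: "0 < \<delta>" "\<And>r i y t. 0 < r \<Longrightarrow> r < \<delta> \<Longrightarrow> y \<in> cball (S x) r \<Longrightarrow> t \<in> {0..r} \<Longrightarrow>
        \<bar>(g i \<circ> T) (y + t *\<^sub>R j) - (g i \<circ> T) y\<bar> \<le> K * (\<alpha> * r)" by blast
      have "\<bar>g i (y + t *\<^sub>R T j) - g i y\<bar> \<le> K * (\<alpha> * r)"
        if "0 < r" "r < \<delta>" "y \<in> cball x r" "t \<in> {0..r}" for r i y t
      proof -
        have "S y \<in> cball (S x) r" using that(3) Tdist[of "S x" "S y"] by (simp add: TS)
        from \<delta>(2)[OF that(1,2) this that(4), of i] show ?thesis
          by (simp add: TS linear_add[OF lin] linear_scale[OF lin])
      qed
      with \<delta>(1) x show False unfolding K_def[symmetric] by blast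
    qed
    then show "x \<in> T ` X" using TS by (metis imageI)
  qed
  ultimately show ?thesis by (rule negligible_subset)
qed

text \<open>Test along \<open>v\<close> itself. The bound is uniform over all components and allows
  a degenerate direction to be replaced by a nearby one.\<close>

lemma norm_gradient_le:
  fixes g :: "'a::euclidean_space \<Rightarrow> real"
  assumes g: "C-lipschitz_on UNIV g" and d: "(g has_derivative (\<lambda>h. v \<bullet> h)) (at x)"
  shows "norm v \<le> C"
proof (cases "v = 0")
  case True
  then show ?thesis using lipschitz_on_nonneg[OF g] by simp
next
  case False
  show ?thesis
  proof (rule field_le_epsilon)
    fix e :: real assume e: "0 < e"
    obtain \<delta> where \<delta>: "0 < \<delta>" "\<And>z. norm (z - x) < \<delta> \<Longrightarrow> norm (g z - g x - v \<bullet> (z - x)) \<le> e * norm (z - x)"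
      using d[unfolded has_derivative_at_alt, THEN conjunct2, rule_format, OF e] by blast
    define s where "s = \<delta> / 2 / norm v"
    have s: "0 < s" "s * norm v < \<delta>" using \<delta> False by (auto simp: s_def)
    have "\<bar>g (x + s *\<^sub>R v) - g x - s * (v \<bullet> v)\<bar> \<le> e * (s * norm v)"
      using \<delta>(2)[of "x + s *\<^sub>R v"] s by simp
    moreover have "\<bar>g (x + s *\<^sub>R v) - g x\<bar> \<le> C * (s * norm v)"
      using lipschitz_onD[OF g, of "x + s *\<^sub>R v" x] s by (simp add: dist_norm)
    ultimately have "s * (v \<bullet> v) \<le> (C + e) * (s * norm v)" unfolding distrib_right by linarith
    then have "(s * norm v) * norm v \<le> (s * norm v) * (C + e)"
      by (simp add: power2_norm_eq_inner[symmetric] power2_eq_square mult_ac)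
    then show "norm v \<le> C + e" using s False by (simp add: mult_le_cancel_left_pos)
  qed
qed

section \<open>Images of rank-deficient points\<close>

text \<open>Cuts the ball into about \<open>n\<^sup>k\<^sup>-\<^sup>1\<close> tubes of width \<open>r / n\<close> in direction \<open>T j\<close>, each of which has an image of
  diameter \<open>O(r / n)\<close>.\<close>
lemma hausdorff_content_tubes:
  fixes f :: "'a::euclidean_space \<Rightarrow> linf" and g :: "nat \<Rightarrow> 'a \<Rightarrow> real" and T :: "'a \<Rightarrow> 'a"
    and r K C :: real and n :: nat
  assumes g: "\<And>i. C-lipschitz_on UNIV (g i)" and fg: "\<And>y i. y \<in> E \<Longrightarrow> apply_bcontfun (f y) i = g i y"
    and T: "orthogonal_transformation T" and j: "j \<in> Basis" and n: "0 < n" and r: "0 < r" and K: "0 \<le> K"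
    and inc: "\<And>i y t. y \<in> cball x (2 * r) \<Longrightarrow> t \<in> {0..2 * r} \<Longrightarrow>
        \<bar>g i (y + t *\<^sub>R T j) - g i y\<bar> \<le> K * (1 / n * (2 * r))"
  shows "hausdorff_content DIM('a) (f ` (E \<inter> cball x r)) \<le>
    ennreal ((3 * (2 * K + C * DIM('a))) ^ DIM('a) * r ^ DIM('a) / n)"
proof -
  define k where "k = DIM('a)"
  have k: "0 < k" by (simp add: k_def)
  define S where "S = inv T"
  have TS: "T (S x) = x" for x
    unfolding S_def by (rule surj_f_inv_f[OF orthogonal_transformation_surj[OF T]])
  have lin: "linear T" and Tn: "norm (T x) = norm x" and Ti: "T x \<bullet> T y = x \<bullet> y" for x y
    using T by (auto simp: orthogonal_transformation_linear orthogonal_transformation_norm orthogonal_transformation_def)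
  have C: "0 \<le> C" using g[of 0] by (rule lipschitz_on_nonneg)
  \<comment> \<open>Two points of the ball are at most \<open>2 * r\<close> apart along the tube,
    which gives \<open>2 * K\<close>; their transverse distance is at most
    \<open>k * (r / n)\<close>, which gives \<open>C * k\<close>.\<close>
  define D where "D = 2 * K + C * k"
  have D: "0 \<le> D" using K C by (simp add: D_def)
  \<comment> \<open>Tubes are indexed by the coordinates transverse to \<open>T j\<close>, rounded
    down in units of \<open>r / n\<close>; inside the ball the indices lie between \<open>-n\<close>
    and \<open>n\<close>. The coordinate along \<open>T j\<close> is left free, whence the exponent
    \<open>k - 1\<close> in the number of tubes.\<close>
  define M where "M = PiE (Basis - {j}) (\<lambda>_. {- int n..int n})"
  define Q where "Q m = {y \<in> E \<inter> cball x r. \<forall>b\<in>Basis - {j}. \<lfloor>(y - x) \<bullet> T b * n / r\<rfloor> = m b}" for m :: "'a \<Rightarrow> int"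
  have "E \<inter> cball x r \<subseteq> (\<Union>m\<in>M. Q m)"
  proof
    fix y assume y: "y \<in> E \<inter> cball x r"
    define m where "m = restrict (\<lambda>b. \<lfloor>(y - x) \<bullet> T b * n / r\<rfloor>) (Basis - {j})"
    have "m b \<in> {- int n..int n}" if b: "b \<in> Basis - {j}" for b
    proof -
      have "\<bar>(y - x) \<bullet> T b\<bar> \<le> norm (y - x) * norm (T b)" by (rule Cauchy_Schwarz_ineq2)
      also have "\<dots> \<le> r" using y b by (simp add: Tn dist_norm norm_minus_commute)
      finally have "\<bar>(y - x) \<bullet> T b\<bar> * n \<le> r * n" by (intro mult_right_mono) auto
      then have "\<bar>(y - x) \<bullet> T b * n / r\<bar> \<le> n" using r by (simp add: abs_mult field_simps)
      then have "- real n \<le> (y - x) \<bullet> T b * n / r" "(y - x) \<bullet> T b * n / r \<le> n" by linarith+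
      then show ?thesis using b by (simp add: m_def le_floor_iff floor_le_iff)
    qed
    then have "m \<in> M" by (auto simp: M_def m_def)
    moreover have "y \<in> Q m" using y by (auto simp: Q_def m_def)
    ultimately show "y \<in> (\<Union>m\<in>M. Q m)" by blast
  qed
  then have cover: "f ` (E \<inter> cball x r) \<subseteq> (\<Union>m\<in>M. f ` Q m)" by blast
  \<comment> \<open>From \<open>z\<close>, move along the tube by \<open>s\<close>, where
    \<open>inc\<close> applies, then transversally to \<open>y\<close>, where the Lipschitz bound
    suffices. \<open>inc\<close> covers only nonnegative \<open>s\<close>; otherwise
    \<open>y\<close> and \<open>z\<close> are interchanged below.\<close>
  have inc_Q: "\<bar>g i y - g i z\<bar> \<le> D * (r / n)"
    if yz: "y \<in> Q m" "z \<in> Q m" and s: "0 \<le> S (y - z) \<bullet> j" for i y z m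
  proof -
    define w where "w = S (y - z)"
    define s where "s = w \<bullet> j"
    have lat: "\<bar>(w - s *\<^sub>R j) \<bullet> b\<bar> \<le> r / n" if b: "b \<in> Basis" for b
    proof (cases "b = j")
      case True
      then show ?thesis using j r by (simp add: s_def inner_diff_left)
    next
      case False
      have "\<lfloor>(y - x) \<bullet> T b * n / r\<rfloor> = \<lfloor>(z - x) \<bullet> T b * n / r\<rfloor>"
        using yz b False by (simp add: Q_def)
      then have "\<bar>(y - x) \<bullet> T b * n / r - (z - x) \<bullet> T b * n / r\<bar> < 1" by linarith
      also have "(y - x) \<bullet> T b * n / r - (z - x) \<bullet> T b * n / r = (y - z) \<bullet> T b * (n / r)"
        by (simp add: inner_diff_left diff_divide_distrib[symmetric] algebra_simps)
      finally have "\<bar>(y - z) \<bullet> T b\<bar> \<le> r / n" using n r by (simp add: abs_mult field_simps)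
      moreover have "(w - s *\<^sub>R j) \<bullet> b = (y - z) \<bullet> T b"
        using Ti[of w b] False b j by (simp add: w_def TS inner_diff_left inner_not_same_Basis)
      ultimately show ?thesis by simp
    qed
    have "norm (w - s *\<^sub>R j) \<le> k * (r / n)" unfolding k_def by (rule norm_le_DIM_mult[OF lat])
    moreover have "T (w - s *\<^sub>R j) = y - (z + s *\<^sub>R T j)"
      by (simp add: linear_diff[OF lin] linear_scale[OF lin] w_def TS)
    ultimately have yz': "norm (y - (z + s *\<^sub>R T j)) \<le> k * (r / n)"
      using Tn[of "w - s *\<^sub>R j"] by simp
    have "norm w = norm (y - z)" using Tn[of w] by (simp add: w_def TS)
    also have "\<dots> \<le> 2 * r"
      using yz dist_triangle2[of y z x] by (auto simp: Q_def dist_norm norm_minus_commute)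
    finally have "s \<le> 2 * r" using Basis_le_norm[OF j, of w] by (simp add: s_def)
    then have "\<bar>g i (z + s *\<^sub>R T j) - g i z\<bar> \<le> K * (1 / n * (2 * r))"
      using yz(2) s r by (intro inc) (auto simp: Q_def s_def w_def)
    moreover have "\<bar>g i y - g i (z + s *\<^sub>R T j)\<bar> \<le> C * (k * (r / n))"
      using order_trans[OF lipschitz_onD[OF g UNIV_I UNIV_I] mult_left_mono[OF yz' C, folded dist_norm]]
      by (simp only: dist_real_def)
    ultimately have "\<bar>g i y - g i z\<bar> \<le> K * (1 / n * (2 * r)) + C * (k * (r / n))" by linarith
    also have "\<dots> = D * (r / n)" by (simp add: D_def algebra_simps)
    finally show ?thesis .
  qed
  have fQ: "dist (f y) (f z) \<le> D * (r / n)" if "y \<in> Q m" "z \<in> Q m" for y z m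
  proof (rule dist_bound)
    fix i
    have "y \<in> E" "z \<in> E" using that by (auto simp: Q_def)
    moreover have "\<bar>g i y - g i z\<bar> \<le> D * (r / n)"
    proof (cases "0 \<le> S (y - z) \<bullet> j")
      case True
      then show ?thesis using inc_Q that by blast
    next
      case False
      have "S (z - y) = - S (y - z)"
        using orthogonal_transformation_linear[OF orthogonal_transformation_inv[OF T]]
        unfolding S_def by (metis linear_neg minus_diff_eq)
      then show ?thesis using inc_Q[OF that(2,1), of i] False by (simp add: abs_minus_commute)
    qed
    ultimately show "dist (apply_bcontfun (f y) i) (apply_bcontfun (f z) i) \<le> D * (r / n)"
      by (simp add: fg dist_real_def)
  qed
  have "hausdorff_content k (f ` (E \<inter> cball x r)) \<le> ennreal (real (card M) * (D * (r / n)) ^ k)"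
  proof (rule hausdorff_content_finite_cover[OF _ cover k])
    show "finite M" unfolding M_def by (rule finite_PiE) auto
    show "bounded (f ` Q m)" for m
      unfolding bounded_two_points using fQ by blast
    show "diameter (f ` Q m) \<le> D * (r / n)" for m
      by (rule diameter_le) (use fQ D r in \<open>auto simp: dist_norm\<close>)
  qed
  also have "\<dots> \<le> ennreal ((3 * D) ^ k * r ^ k / n)"
  proof (rule ennreal_leI)
    have "card M = (2 * n + 1) ^ (k - 1)"
    proof -
      have "card {- int n..int n} = 2 * n + 1" by simp
      then show ?thesis unfolding M_def using j by (simp add: card_PiE k_def del: card_atLeastAtMost_int)
    qed
    then have "real (card M) = (2 * real n + 1) ^ (k - 1)" by (simp add: add.commute)
    also have "\<dots> \<le> (3 * real n) ^ (k - 1)" using n by (intro power_mono) auto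
    finally have "real (card M) * (D * (r / n)) ^ k \<le> (3 * real n) ^ (k - 1) * (D * (r / n)) ^ k"
      using D r by (intro mult_right_mono) auto
    also have "\<dots> = 3 ^ (k - 1) * (D ^ k * r ^ k / n)"
      using n k power_minus_mult[OF k, of "real n"] by (simp add: power_mult_distrib power_divide field_simps)
    also have "\<dots> \<le> 3 ^ k * (D ^ k * r ^ k / n)"
      using D r by (intro mult_right_mono power_increasing) auto
    also have "\<dots> = (3 * D) ^ k * r ^ k / n" by (simp add: power_mult_distrib)
    finally show "real (card M) * (D * (r / n)) ^ k \<le> (3 * D) ^ k * r ^ k / n" .
  qed
  finally show ?thesis unfolding k_def D_def .
qed

text \<open>For each tolerance \<open>\<alpha> n\<close>, the degenerate direction \<open>u\<close>
  at \<open>x\<close> is replaced by a nearby \<open>u'\<close> from the countable set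
  \<open>D\<close>. The slopes in direction \<open>u'\<close> are still at most
  \<open>\<alpha> n\<close>, and the exceptional set for \<open>u'\<close> belongs to the null set
  \<open>W\<close> fixed beforehand.\<close>

lemma hausdorff_content_image_rank_deficient:
  fixes f :: "real ^ 'k \<Rightarrow> linf" and g :: "nat \<Rightarrow> real ^ 'k \<Rightarrow> real"
  assumes g: "\<And>i. C-lipschitz_on UNIV (g i)" and fg: "\<And>y i. y \<in> E \<Longrightarrow> apply_bcontfun (f y) i = g i y"
  defines "A \<equiv> {x \<in> E. \<exists>v u. (\<forall>i. (g i has_derivative (\<lambda>h. v i \<bullet> h)) (at x)) \<and> norm u = 1 \<and> (\<forall>i. v i \<bullet> u = 0)}"
  shows "hausdorff_content DIM(real^'k) (f ` A) = 0"
proof -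
  define k where "k = DIM(real^'k)"
  have k: "0 < k" by (simp add: k_def)
  have C: "0 \<le> C" using g[of 0] by (rule lipschitz_on_nonneg)
  obtain j :: "real^'k" where j: "j \<in> Basis" using nonempty_Basis by blast
  obtain D :: "(real^'k) set" where D: "countable D" "D \<subseteq> sphere 0 1" "sphere 0 1 \<subseteq> closure D"
    using separable by blast
  have "\<exists>T :: real^'k \<Rightarrow> real^'k. orthogonal_transformation T \<and> T j = u" if "u \<in> D" for u
    using orthogonal_transformation_exists_1[of j u] that D(2) j by (auto simp: subset_iff)
  then obtain T :: "real^'k \<Rightarrow> real^'k \<Rightarrow> real^'k" where
      T: "\<And>u. u \<in> D \<Longrightarrow> orthogonal_transformation (T u)" "\<And>u. u \<in> D \<Longrightarrow> T u j = u"
    by metis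
  define K where "K = 2 + C + 2 * C * k + (10 * (1 + 2 * C)) ^ k"
  have K: "0 \<le> K" using C by (simp add: K_def)
  \<comment> \<open>The same number bounds the slopes along a tube and the ratio of its width to the
    radius of the ball, so both contributions to the diameter of the image are of order
    \<open>r / Suc n\<close>.\<close>
  define \<alpha> :: "nat \<Rightarrow> real" where "\<alpha> n = 1 / Suc n" for n
  have \<alpha>: "0 < \<alpha> n" "\<alpha> n \<le> 1" for n by (auto simp: \<alpha>_def)
  define good where "good n u x \<longleftrightarrow> (\<exists>\<delta>>0. \<forall>r. 0 < r \<and> r < \<delta> \<longrightarrow> (\<forall>i. \<forall>y\<in>cball x r. \<forall>t\<in>{0..r}.
        \<bar>g i (y + t *\<^sub>R T u j) - g i y\<bar> \<le> K * (\<alpha> n * r)))" for n u x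
  define X where "X n u = {x. (\<forall>i. \<exists>v. (g i has_derivative (\<lambda>h. v \<bullet> h)) (at x) \<and> \<bar>v \<bullet> T u j\<bar> \<le> \<alpha> n) \<and> \<not> good n u x}" for n u
  define W where "W = (\<Union>n. \<Union>u\<in>D. X n u)"
  have "negligible (X n u)" if "u \<in> D" for n u
    unfolding X_def good_def K_def k_def by (rule uniform_increments_rotated[OF g j T(1)[OF that] \<alpha>])
  then have W: "negligible W"
    unfolding W_def by (intro negligible_UN_countable) (auto simp: D(1))
  \<comment> \<open>Bounded pieces fit into a ball of finite volume, as the limit over
    \<open>n\<close> requires.\<close>
  define Y where "Y R = {x \<in> A - W. norm x < real R}" for R :: nat
  \<comment> \<open>The factor 5 is the Vitali enlargement; dividing by
    \<open>unit_ball_vol k\<close> expresses the tube estimate through the volume of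
    \<open>cball x \<rho>\<close>.\<close>
  define c where "c = (3 * (2 * K + C * k) * 5) ^ k / unit_ball_vol k"
  have v: "0 < unit_ball_vol k" by simp
  have c: "0 \<le> c" unfolding c_def using K C v by (intro divide_nonneg_pos zero_le_power mult_nonneg_nonneg add_nonneg_nonneg) auto
  have YR: "hausdorff_content k (f ` Y R) \<le> ennreal (c / Suc n) * emeasure lborel (ball 0 (real R + 1) :: (real^'k) set)" for R n
  proof -
    let ?N = "scale_measure (ennreal (c / Suc n)) lborel :: (real^'k) measure"
    have "hausdorff_content k (f ` Y R) \<le> emeasure ?N (ball 0 (real R + 1))"
    proof (rule hausdorff_content_image_le_Vitali[OF k])
      fix x assume x: "x \<in> Y R"
      then obtain v u where vu: "\<And>i. (g i has_derivative (\<lambda>h. v i \<bullet> h)) (at x)" "norm u = 1" "\<And>i. v i \<bullet> u = 0"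
        unfolding Y_def A_def by blast
      have xW: "x \<notin> W" and xR: "norm x < R" using x by (auto simp: Y_def)
      have "u \<in> closure D" using vu(2) D(3) by auto
      moreover have "0 < \<alpha> n / (C + 1)" using \<alpha>[of n] C by simp
      ultimately obtain u' where u': "u' \<in> D" "dist u' u < \<alpha> n / (C + 1)"
        unfolding closure_approachable by blast
      have "\<bar>v i \<bullet> T u' j\<bar> \<le> \<alpha> n" for i
      proof -
        have "v i \<bullet> T u' j = v i \<bullet> (u' - u)" using vu(3) T(2)[OF u'(1)] by (simp add: inner_diff_right)
        then have "\<bar>v i \<bullet> T u' j\<bar> \<le> norm (v i) * norm (u' - u)" using Cauchy_Schwarz_ineq2 by metis
        also have "\<dots> \<le> (C + 1) * (\<alpha> n / (C + 1))"
          using norm_gradient_le[OF g vu(1), of i] u'(2) C by (intro mult_mono) (auto simp: dist_norm)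
        finally show ?thesis using C by simp
      qed
      then have "good n u' x" using xW u'(1) vu(1) unfolding W_def X_def by blast
      then obtain \<delta> where \<delta>: "0 < \<delta>" "\<And>r i y t. 0 < r \<Longrightarrow> r < \<delta> \<Longrightarrow> y \<in> cball x r \<Longrightarrow> t \<in> {0..r} \<Longrightarrow>
          \<bar>g i (y + t *\<^sub>R T u' j) - g i y\<bar> \<le> K * (\<alpha> n * r)" unfolding good_def by blast
      \<comment> \<open>The tubes are taken in the enlarged ball of radius \<open>5 * \<rho>\<close>
        and use increments up to \<open>10 * \<rho>\<close>, which must stay below
        \<open>\<delta>\<close>.\<close>
      define \<rho> where "\<rho> = min 1 (\<delta> / 11)"
      have \<rho>: "0 < \<rho>" "\<rho> \<le> 1" "2 * (5 * \<rho>) < \<delta>" using \<delta>(1) by (auto simp: \<rho>_def min_def)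
      have "hausdorff_content k (f ` (Y R \<inter> cball x (5 * \<rho>))) \<le> hausdorff_content k (f ` (E \<inter> cball x (5 * \<rho>)))"
        by (rule hausdorff_content_mono) (auto simp: Y_def A_def)
      also have "\<dots> \<le> ennreal ((3 * (2 * K + C * k)) ^ k * (5 * \<rho>) ^ k / Suc n)"
        unfolding k_def
      proof (rule hausdorff_content_tubes[OF g fg T(1)[OF u'(1)] j _ _ K])
        show "\<bar>g i (y + t *\<^sub>R T u' j) - g i y\<bar> \<le> K * (1 / real (Suc n) * (2 * (5 * \<rho>)))"
          if "y \<in> cball x (2 * (5 * \<rho>))" "t \<in> {0..2 * (5 * \<rho>)}" for i y t
          using \<delta>(2)[OF _ \<rho>(3) that, of i] \<rho>(1) by (simp add: \<alpha>_def)
      qed (use \<rho> in auto)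
      also have "(3 * (2 * K + C * k)) ^ k * (5 * \<rho>) ^ k / Suc n =
          (3 * (2 * K + C * k) * 5) ^ k * \<rho> ^ k / Suc n"
        by (simp only: power_mult_distrib mult.assoc)
      also have "\<dots> = c / Suc n * (unit_ball_vol k * \<rho> ^ k)"
        using less_imp_neq[OF v, symmetric] by (simp add: c_def)
      also have "ennreal \<dots> = emeasure ?N (cball x \<rho>)"
        unfolding emeasure_scale_measure using \<rho> emeasure_cball[of \<rho> x] v
        by (subst ennreal_mult'') (auto simp: k_def)
      finally have "hausdorff_content k (f ` (Y R \<inter> cball x (5 * \<rho>))) \<le> emeasure ?N (cball x \<rho>)" .
      moreover have "cball x \<rho> \<subseteq> ball 0 (real R + 1)"
      proof
        fix y assume "y \<in> cball x \<rho>"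
        then have "norm (y - x) \<le> 1" using \<rho>(2) by (simp add: dist_norm norm_minus_commute)
        then show "y \<in> ball 0 (real R + 1)" using xR norm_triangle_sub[of y x] by simp
      qed
      ultimately show "\<exists>r>0. r \<le> 1 \<and> cball x r \<subseteq> ball 0 (real R + 1) \<and>
          hausdorff_content k (f ` (Y R \<inter> cball x (5 * r))) \<le> emeasure ?N (cball x r)"
        using \<rho> by blast
    qed auto
    then show ?thesis by simp
  qed
  have Y0: "hausdorff_content k (f ` Y R) = 0" for R
  proof -
    define V where "V = measure lborel (ball 0 (real R + 1) :: (real^'k) set)"
    have V: "emeasure lborel (ball 0 (real R + 1) :: (real^'k) set) = ennreal V" "0 \<le> V"
      unfolding V_def by (use emeasure_bounded_finite[of "ball (0 :: real^'k) (real R + 1)"] in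
          \<open>auto intro!: emeasure_eq_ennreal_measure simp: less_top\<close>)
    have "hausdorff_content k (f ` Y R) \<le> ennreal (c * V / Suc n)" for n
      using YR[of R n] V c by (simp add: ennreal_mult'[symmetric])
    moreover have "(\<lambda>n. ennreal (c * V / Suc n)) \<longlonglongrightarrow> ennreal 0"
      by (intro tendsto_ennrealI) (rule LIMSEQ_Suc[OF lim_const_over_n])
    \<comment> \<open>The left side does not depend on \<open>n\<close>, so the tolerance may tend
      to zero.\<close>
    ultimately have "hausdorff_content k (f ` Y R) \<le> ennreal 0"
      by (intro LIMSEQ_le_const) auto
    then show ?thesis by simp
  qed
  have fL: "C-lipschitz_on E f"
  proof (rule lipschitz_onI)
    fix x y assume "x \<in> E" "y \<in> E"
    then show "dist (f x) (f y) \<le> C * dist x y"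
      using lipschitz_onD[OF g, of x y] by (intro dist_bound) (auto simp: fg)
  qed (rule C)
  have null1: "hausdorff_content k (f ` (A \<inter> W)) = 0"
    unfolding k_def
  proof (rule hausdorff_content_lipschitz_image_negligible)
    show "C-lipschitz_on (A \<inter> W) f" using fL by (rule lipschitz_on_subset) (auto simp: A_def)
    show "negligible (A \<inter> W)" using W by (rule negligible_subset) auto
  qed
  have null2: "hausdorff_content k (\<Union>R. f ` Y R) = 0"
    by (rule hausdorff_content_UN_countable_null) (auto simp: Y0 k)
  have "f ` A \<subseteq> f ` (A \<inter> W) \<union> (\<Union>R. f ` Y R)"
  proof
    fix z assume "z \<in> f ` A"
    then obtain x where x: "x \<in> A" "z = f x" by blast
    obtain R :: nat where "norm x < R" using reals_Archimedean2 by blast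
    then show "z \<in> f ` (A \<inter> W) \<union> (\<Union>R. f ` Y R)" using x by (auto simp: Y_def)
  qed
  from hausdorff_content_null_cover[OF this null1 null2 k] show ?thesis by (simp only: k_def)
qed

section \<open>Null images and rank deficiency almost everywhere\<close>

lemma AE_lebesgue_on_iff_negligible:
  fixes E :: "'a::euclidean_space set"
  assumes "E \<in> sets lebesgue"
  shows "(AE x in lebesgue_on E. P x) \<longleftrightarrow> negligible {x \<in> E. \<not> P x}"
proof -
  have "(AE x in lebesgue_on E. P x) \<longleftrightarrow> (AE x in lebesgue. x \<in> E \<longrightarrow> P x)"
    using assms by (intro AE_restrict_space_iff) auto
  also have "\<dots> \<longleftrightarrow> (\<exists>N\<in>null_sets lebesgue. {x \<in> E. \<not> P x} \<subseteq> N)"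
    unfolding eventually_ae_filter by simp
  also have "\<dots> \<longleftrightarrow> negligible {x \<in> E. \<not> P x}"
    by (metis negligible_iff_null_sets negligible_subset order_refl)
  finally show ?thesis .
qed

theorem theorem2p2:
  fixes E :: "(real ^ 'k) set"
    and f :: "real ^ 'k \<Rightarrow> linf"
    and C :: real
  assumes "E \<in> sets lebesgue"
    and "C-lipschitz_on E f"
  shows "hausdorff_measure CARD('k) (f ` E) = 0 \<longleftrightarrow>
         (AE x in lebesgue_on E. rank_seq (apD_linf f E x) < CARD('k))"
proof -
  let ?k = "DIM(real^'k)"
  have k: "CARD('k) = ?k" by simp
  have "\<exists>h. C-lipschitz_on UNIV h \<and> (\<forall>x\<in>E. h x = apply_bcontfun (f x) i)" for i
  proof -
    have "C-lipschitz_on E (\<lambda>x. apply_bcontfun (f x) i)"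
      using assms(2) by (auto simp: lipschitz_on_def intro: order_trans[OF dist_bounded])
    then show ?thesis by (rule McShane_extension) blast
  qed
  then obtain g where g: "\<And>i. C-lipschitz_on UNIV (g i)"
      and fg: "\<And>x i. x \<in> E \<Longrightarrow> apply_bcontfun (f x) i = g i x" by metis
  \<comment> \<open>At points of \<open>E\<close> outside this null set, all components of
    \<open>apD_linf f E x\<close> are classical gradients of the extensions
    \<open>g i\<close>.\<close>
  define W where "W = {x \<in> E. \<not> full_density E x} \<union> (\<Union>i. {x. \<not> (\<exists>v. (g i has_derivative (\<lambda>h. v \<bullet> h)) (at x))})"
  have W: "negligible W"
    unfolding W_def
    by (intro negligible_Un Lebesgue_density[OF assms(1)] negligible_UN_countable Rademacher[OF g]) auto
  define D where "D x = apD_linf f E x" for x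
  have D: "(g i has_derivative (\<lambda>h. D x i \<bullet> h)) (at x)" if x: "x \<in> E - W" for x i
  proof -
    obtain v where v: "(g i has_derivative (\<lambda>h. v \<bullet> h)) (at x)" using x by (auto simp: W_def)
    have "density_point E x"
      using x by (intro density_point_if_full_density assms(1)) (auto simp: W_def)
    then have "D x i = v"
      unfolding D_def apD_linf_def using x v
      by (intro apD_eq_derivative[OF assms(1), of _ "g i"]) (auto simp: fg)
    then show ?thesis using v by simp
  qed
  have "hausdorff_measure CARD('k) (f ` E) = 0 \<longleftrightarrow> hausdorff_content ?k (f ` E) = 0"
    unfolding k by (rule hausdorff_measure_eq_0_iff) simp
  also have "\<dots> \<longleftrightarrow> negligible {x \<in> E. \<not> rank_seq (D x) < ?k}"
  proof
    assume "hausdorff_content ?k (f ` E) = 0"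
    note null = negligible_lower_Lipschitz[OF this]
    have "{x \<in> E. \<not> rank_seq (D x) < ?k} \<subseteq> W \<union>
        {x \<in> E. \<exists>n. \<forall>y\<in>E. norm (y - x) < 1 / Suc n \<longrightarrow> norm (y - x) \<le> Suc n * dist (f y) (f x)}"
    proof
      fix x assume x: "x \<in> {x \<in> E. \<not> rank_seq (D x) < ?k}"
      show "x \<in> W \<union> {x \<in> E. \<exists>n. \<forall>y\<in>E. norm (y - x) < 1 / Suc n \<longrightarrow> norm (y - x) \<le> Suc n * dist (f y) (f x)}"
      proof (cases "x \<in> W")
        case False
        have "\<exists>n. \<forall>y\<in>E. norm (y - x) < 1 / Suc n \<longrightarrow> norm (y - x) \<le> Suc n * dist (f y) (f x)"
        proof (rule lower_Lipschitz_at_full_rank)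
          show "\<bar>g i y - g i z\<bar> \<le> dist (f y) (f z)" if "y \<in> E" "z \<in> E" for i y z
            using dist_bounded[of "f y" i "f z"] that by (simp add: fg dist_real_def)
          show "(g i has_derivative (\<lambda>h. D x i \<bullet> h)) (at x)" for i using D x False by blast
          show "\<not> (\<exists>u. norm u = 1 \<and> (\<forall>i. D x i \<bullet> u = 0))"
            using x rank_seq_less_iff[of "D x"] by blast
        qed (use x in blast)
        then show ?thesis using x by blast
      qed simp
    qed
    then show "negligible {x \<in> E. \<not> rank_seq (D x) < ?k}"
      using negligible_subset[OF negligible_Un[OF W null]] by blast
  next
    assume null: "negligible {x \<in> E. \<not> rank_seq (D x) < ?k}"
    \<comment> \<open>\<open>B\<close> collects the points without derivative information and those
      of full rank. It is null, so its Lipschitz image is null; every other point of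
      \<open>E\<close> is rank-deficient in the sense of \<open>A\<close>.\<close>
    define B where "B = E \<inter> (W \<union> {x \<in> E. \<not> rank_seq (D x) < ?k})"
    define A where "A = {x \<in> E. \<exists>v u. (\<forall>i. (g i has_derivative (\<lambda>h. v i \<bullet> h)) (at x)) \<and> norm u = 1 \<and> (\<forall>i. v i \<bullet> u = 0)}"
    have "x \<in> A" if x: "x \<in> E" "x \<notin> B" for x
    proof -
      have "x \<in> E - W" "rank_seq (D x) < ?k" using x unfolding B_def by blast+
      then obtain u where "norm u = 1" "\<forall>i. D x i \<bullet> u = 0" unfolding rank_seq_less_iff by blast
      moreover have "\<forall>i. (g i has_derivative (\<lambda>h. D x i \<bullet> h)) (at x)" using D[OF \<open>x \<in> E - W\<close>] by blast
      ultimately show ?thesis using x(1) unfolding A_def by blast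
    qed
    then have sub: "f ` E \<subseteq> f ` B \<union> f ` A" by blast
    have nB: "negligible B" using negligible_Un[OF W null] by (rule negligible_subset) (auto simp: B_def)
    have "C-lipschitz_on B f" using assms(2) by (rule lipschitz_on_subset) (auto simp: B_def)
    note null_B = hausdorff_content_lipschitz_image_negligible[OF this nB]
    have null_A: "hausdorff_content ?k (f ` A) = 0"
      unfolding A_def by (rule hausdorff_content_image_rank_deficient[OF g fg])
    show "hausdorff_content ?k (f ` E) = 0"
      by (rule hausdorff_content_null_cover[OF sub null_B null_A]) simp
  qed
  also have "\<dots> \<longleftrightarrow> (AE x in lebesgue_on E. rank_seq (apD_linf f E x) < CARD('k))"
    unfolding AE_lebesgue_on_iff_negligible[OF assms(1)] D_def k ..
  finally show ?thesis .
qed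

end
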